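(* Let $\{E_\lambda:\lambda\in\Lambda\}$ be a family of real Banach spaces, and let $E=[\bigoplus_{\lambda\in\Lambda}E_\lambda]_F$ where $F=c_0$ or $F=l_1$. Then $E$ is a GL-space if and only if each $E_\lambda$ is a GL-space.
   Context: All spaces are over the real field. $B_E$, $S_E$, $E^*$ denote the closed unit ball, the unit sphere and the dual of $E$. $[\bigoplus_{\lambda\in\Lambda}E_\lambda]_{c_0}$ and $[\bigoplus_{\lambda\in\Lambda}E_\lambda]_{l_1}$ denote the $c_0$-sum (families $(x_\lambda)$ with $(\|x_\lambda\|)\in c_0(\Lambda)$, norm $\sup_\lambda\|x_\lambda\|$) and the $l_1$-sum (families with $(\|x_\lambda\|)\in l_1(\Lambda)$, norm $\sum_\lambda\|x_\lambda\|$). A Banach space $E$ is a GL-space (generalized-lush space) if for every $x\in S_E$ and every $\varepsilon>0$ there is $x^*\in S_{E^*}$ such that, with $S=S(x^*,\varepsilon)=\{z\in B_E: x^*(z)>1-\varepsilon\}$, one has $x\in S$ and $\mathrm{dist}(y,S)+\mathrm{dist}(y,-S)<2+\varepsilon$ for all $y\in S_E$. *)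

theory Defs
  imports "HOL-Analysis.Analysis" "HOL-Algebra.Algebraic_Closure_Type"
begin

text \<open>
  A family of Banach spaces whose underlying spaces vary with the index cannot be a family of
  types, so normed spaces are records with an explicit carrier: modules in the sense of
  HOL-Algebra over the field of real numbers, extended by a norm. The inherited ring fields
  \<open>mult\<close> and \<open>one\<close> play no role, as usual for modules in HOL-Algebra.
\<close>

record 'a normed_space = "(real, 'a) module" +
  nrm :: "'a \<Rightarrow> real"

locale real_normed_space = Module.module "ring_of_type_algebra :: real ring" E
  for E :: "'a normed_space" (structure) +
  assumes nrm_nonneg: "x \<in> carrier E \<Longrightarrow> 0 \<le> nrm E x"
    and nrm_eq_zero_iff: "x \<in> carrier E \<Longrightarrow> nrm E x = 0 \<longleftrightarrow> x = \<zero>"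
    and nrm_smult: "x \<in> carrier E \<Longrightarrow> nrm E (a \<odot> x) = \<bar>a\<bar> * nrm E x"
    and nrm_triangle:
      "x \<in> carrier E \<Longrightarrow> y \<in> carrier E \<Longrightarrow> nrm E (x \<oplus> y) \<le> nrm E x + nrm E y"

text \<open>
  The locale \<open>Metric_space\<close> requires the distance to be nonnegative and symmetric even off the
  carrier, hence the default value \<open>0\<close> there.
\<close>

definition nrm_dist :: "'a normed_space \<Rightarrow> 'a \<Rightarrow> 'a \<Rightarrow> real" where
  "nrm_dist E x y =
     (if x \<in> carrier E \<and> y \<in> carrier E then nrm E (x \<ominus>\<^bsub>E\<^esub> y) else 0)"

locale banach_space = real_normed_space +
  assumes complete: "Metric_space.mcomplete (carrier E) (nrm_dist E)"

definition unit_ball :: "'a normed_space \<Rightarrow> 'a set" where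
  "unit_ball E = {x \<in> carrier E. nrm E x \<le> 1}"

definition unit_sphere :: "'a normed_space \<Rightarrow> 'a set" where
  "unit_sphere E = {x \<in> carrier E. nrm E x = 1}"

text \<open>
  Functionals are taken to be extensional, so that they are determined by their values on the
  carrier.
\<close>

definition dual :: "'a normed_space \<Rightarrow> ('a \<Rightarrow> real) set" where
  "dual E = {f \<in> extensional (carrier E).
     (\<forall>x \<in> carrier E. \<forall>y \<in> carrier E. f (x \<oplus>\<^bsub>E\<^esub> y) = f x + f y) \<and>
     (\<forall>a. \<forall>x \<in> carrier E. f (a \<odot>\<^bsub>E\<^esub> x) = a * f x) \<and>
     (\<exists>C. \<forall>x \<in> carrier E. \<bar>f x\<bar> \<le> C * nrm E x)}"

definition dual_nrm :: "'a normed_space \<Rightarrow> ('a \<Rightarrow> real) \<Rightarrow> real" where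
  "dual_nrm E f = (SUP x \<in> unit_ball E. \<bar>f x\<bar>)"

definition dual_unit_sphere :: "'a normed_space \<Rightarrow> ('a \<Rightarrow> real) set" where
  "dual_unit_sphere E = {f \<in> dual E. dual_nrm E f = 1}"

definition slice :: "'a normed_space \<Rightarrow> ('a \<Rightarrow> real) \<Rightarrow> real \<Rightarrow> 'a set" where
  "slice E f \<epsilon> = {z \<in> unit_ball E. f z > 1 - \<epsilon>}"

text \<open>Meaningful only for nonempty \<open>A\<close>; the slices it is applied to below contain \<open>x\<close>.\<close>

definition dist_to_set :: "'a normed_space \<Rightarrow> 'a \<Rightarrow> 'a set \<Rightarrow> real" where
  "dist_to_set E y A = (INF z \<in> A. nrm_dist E y z)"

definition GL_space :: "'a normed_space \<Rightarrow> bool" where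
  "GL_space E \<longleftrightarrow> banach_space E \<and>
     (\<forall>x \<in> unit_sphere E. \<forall>\<epsilon>>0. \<exists>f \<in> dual_unit_sphere E.
        x \<in> slice E f \<epsilon> \<and>
        (\<forall>y \<in> unit_sphere E.
           dist_to_set E y (slice E f \<epsilon>)
             + dist_to_set E y ((\<lambda>z. \<ominus>\<^bsub>E\<^esub> z) ` slice E f \<epsilon>) < 2 + \<epsilon>))"

text \<open>
  \<open>direct_sum \<Lambda> E C N\<close> consists of the families over \<open>\<Lambda>\<close> whose family of norms lies in the
  space \<open>C\<close> of real families, and is normed by applying \<open>N\<close> to the family of norms.
\<close>

definition direct_sum ::
  "'i set \<Rightarrow> ('i \<Rightarrow> 'a normed_space) \<Rightarrow> ('i \<Rightarrow> real) set \<Rightarrow> (('i \<Rightarrow> real) \<Rightarrow> real)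
     \<Rightarrow> ('i \<Rightarrow> 'a) normed_space" where
  "direct_sum \<Lambda> E C N = \<lparr>
     carrier = {x \<in> \<Pi>\<^sub>E i\<in>\<Lambda>. carrier (E i). (\<lambda>i. nrm (E i) (x i)) \<in> C},
     monoid.mult = undefined,
     one = undefined,
     ring.zero = (\<lambda>i\<in>\<Lambda>. \<zero>\<^bsub>E i\<^esub>),
     add = (\<lambda>x y. \<lambda>i\<in>\<Lambda>. x i \<oplus>\<^bsub>E i\<^esub> y i),
     smult = (\<lambda>a x. \<lambda>i\<in>\<Lambda>. a \<odot>\<^bsub>E i\<^esub> x i),
     nrm = (\<lambda>x. N (\<lambda>i. nrm (E i) (x i)))\<rparr>"

definition c0_families :: "'i set \<Rightarrow> ('i \<Rightarrow> real) set" where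
  "c0_families \<Lambda> = {a. \<forall>\<delta>>0. finite {i \<in> \<Lambda>. \<bar>a i\<bar> \<ge> \<delta>}}"

definition l1_families :: "'i set \<Rightarrow> ('i \<Rightarrow> real) set" where
  "l1_families \<Lambda> = {a. (\<lambda>i. \<bar>a i\<bar>) summable_on \<Lambda>}"

text \<open>The inserted \<open>0\<close> matters only for empty \<open>\<Lambda>\<close>, where the supremum should be \<open>0\<close>.\<close>

definition c0_sum ::
  "'i set \<Rightarrow> ('i \<Rightarrow> 'a normed_space) \<Rightarrow> ('i \<Rightarrow> 'a) normed_space" where
  "c0_sum \<Lambda> E = direct_sum \<Lambda> E (c0_families \<Lambda>) (\<lambda>a. Sup (insert 0 ((\<lambda>i. \<bar>a i\<bar>) ` \<Lambda>)))"

definition l1_sum ::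
  "'i set \<Rightarrow> ('i \<Rightarrow> 'a normed_space) \<Rightarrow> ('i \<Rightarrow> 'a) normed_space" where
  "l1_sum \<Lambda> E = direct_sum \<Lambda> E (l1_families \<Lambda>) (\<lambda>a. \<Sum>\<^sub>\<infinity>i\<in>\<Lambda>. \<bar>a i\<bar>)"

end

(*
  Up to normalising the functional, E is a GL-space iff for every x in the unit sphere and every
  positive epsilon some functional f of norm at most 1 has f x >= 1 - epsilon, and every y in the
  sphere admits z, w in the ball with f z, f w >= 1 - epsilon and
  |y - z| + |y + w| <= 2 + epsilon; by convexity the same holds for every y in the ball.

  From the sum to a component: restrict the functional to the i-th summand and project z, w to the
  i-th coordinate, adding a multiple of x to make up for the norm of the other coordinates in the
  l1-case.  From the components to the c0-sum: the norm of x is attained at some coordinate i, and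
  the functional of E i at x i, composed with the i-th projection, works.  From the components to
  the l1-sum: add up functionals of the E i at the normalised coordinates of x, and choose z, w
  coordinatewise, scaled by the norms of the coordinates of y.
*)

theory Submission
  imports Defs
begin

text \<open>Two mismatches shape the proof. Restrictions, compositions and sums of norm-one
  functionals need not have norm one, so all constructions are done with contractive functionals.
  And the coordinates of a unit vector \<open>y\<close> are not unit vectors: the
  \<open>c0\<close>-sum needs approximation for all points of the ball, the \<open>l1\<close>-sum
  needs it at radius \<open>nrm (E i) (y i)\<close>, so that the inequalities can be added up. The
  functional is fixed before \<open>y\<close>, so on coordinates where \<open>x\<close> vanishes a
  suitable functional is required as well: \<open>y\<close> may live there. Projecting a point
  \<open>p\<close> of a slice of the sum is delicate because the coordinates other than
  \<open>i\<close> might carry most of \<open>f p\<close>. They do not: replacing coordinate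
  \<open>i\<close> of \<open>p\<close> by \<open>x\<close> gives a point of norm at most
  \<open>1 + s\<close>, and \<open>x\<close> alone already has value at least
  \<open>1 - \<epsilon>\<close>, so the rest has value at most \<open>s + \<epsilon>\<close>. Adding
  \<open>s\<close> times \<open>x\<close> to the projection restores this up to multiples of
  \<open>\<epsilon>\<close>, and the distances do not grow, since \<open>s\<close> is what the
  discarded coordinates contributed to the norm.\<close>

section \<open>Real normed spaces\<close>

context real_normed_space
begin

lemma smult_in_carrier [simp, intro]: "x \<in> carrier E \<Longrightarrow> a \<odot> x \<in> carrier E"
  using smult_closed[of a x] by (simp add: ring_of_type_algebra_def)

lemma smult_add_left: "x \<in> carrier E \<Longrightarrow> (a + b) \<odot> x = a \<odot> x \<oplus> b \<odot> x"
  using smult_l_distr[of a b x] by (simp add: ring_of_type_algebra_def)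

lemma smult_add_right:
  "x \<in> carrier E \<Longrightarrow> y \<in> carrier E \<Longrightarrow> a \<odot> (x \<oplus> y) = a \<odot> x \<oplus> a \<odot> y"
  using smult_r_distr[of a x y] by (simp add: ring_of_type_algebra_def)

lemma smult_smult: "x \<in> carrier E \<Longrightarrow> a \<odot> (b \<odot> x) = (a * b) \<odot> x"
  using smult_assoc1[of a b x] by (simp add: ring_of_type_algebra_def)

lemma smult_1 [simp]: "x \<in> carrier E \<Longrightarrow> 1 \<odot> x = x"
  using smult_one[of x] by (simp add: ring_of_type_algebra_def)

lemma smult_0_left [simp]: "x \<in> carrier E \<Longrightarrow> 0 \<odot> x = \<zero>"
  using smult_l_null[of x] by (simp add: ring_of_type_algebra_def)

lemma smult_0_right [simp]: "a \<odot> \<zero> = \<zero>"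
  using smult_r_null[of a] by (simp add: ring_of_type_algebra_def)

lemma a_inv_eq_smult: "x \<in> carrier E \<Longrightarrow> \<ominus> x = (-1) \<odot> x"
proof -
  assume x: "x \<in> carrier E"
  have "(-1) \<odot> x \<oplus> x = (-1 + 1) \<odot> x"
    using x smult_add_left[of x "-1" 1] by simp
  also have "\<dots> = \<zero>" using x by simp
  finally show ?thesis using x minus_equality by simp
qed

lemma minus_eq_smult: "x \<in> carrier E \<Longrightarrow> y \<in> carrier E \<Longrightarrow> x \<ominus> y = x \<oplus> (-1) \<odot> y"
  by (simp add: a_minus_def a_inv_eq_smult)

lemma nrm_zero [simp]: "nrm E \<zero> = 0"
  using nrm_eq_zero_iff by simp

lemma nrm_minus_commute:
  assumes "x \<in> carrier E" "y \<in> carrier E"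
  shows "nrm E (x \<ominus> y) = nrm E (y \<ominus> x)"
proof -
  have "y \<ominus> x = (-1) \<odot> (x \<ominus> y)"
    using assms by (simp add: minus_eq_smult smult_add_right smult_smult a_comm)
  thus ?thesis using assms by (simp add: nrm_smult)
qed

lemma nrm_minus_triangle:
  assumes "x \<in> carrier E" "y \<in> carrier E" "z \<in> carrier E"
  shows "nrm E (x \<ominus> z) \<le> nrm E (x \<ominus> y) + nrm E (y \<ominus> z)"
proof -
  have "x \<ominus> z = (x \<ominus> y) \<oplus> (y \<ominus> z)"
    using assms by (simp add: a_minus_def a_assoc r_neg1)
  thus ?thesis using assms nrm_triangle[of "x \<ominus> y" "y \<ominus> z"] by simp
qed

lemma minus_eq_zero_iff:
  assumes "x \<in> carrier E" "y \<in> carrier E"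
  shows "x \<ominus> y = \<zero> \<longleftrightarrow> x = y"
proof
  assume "x \<ominus> y = \<zero>"
  hence "x \<oplus> \<ominus> y = \<zero>" by (simp add: a_minus_def)
  hence "\<ominus> (\<ominus> y) = x" using assms by (intro minus_equality) auto
  thus "x = y" using assms by simp
qed (use assms in \<open>simp add: a_minus_def r_neg\<close>)

lemma nrm_minus_self [simp]: "x \<in> carrier E \<Longrightarrow> nrm E (x \<ominus> x) = 0"
  using minus_eq_zero_iff[of x x] by simp

lemma minus_a_inv: "x \<in> carrier E \<Longrightarrow> y \<in> carrier E \<Longrightarrow> x \<ominus> (\<ominus> y) = x \<oplus> y"
  by (simp add: a_minus_def)

lemma nrm_diff_abs:
  assumes "x \<in> carrier E" "y \<in> carrier E"
  shows "\<bar>nrm E x - nrm E y\<bar> \<le> nrm E (x \<ominus> y)"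
  using nrm_minus_triangle[OF assms(1,2), of \<zero>] nrm_minus_triangle[OF assms(2,1), of \<zero>]
    nrm_minus_commute[OF assms] assms by (simp add: minus_eq_smult)

lemma Metric_space_nrm_dist: "Metric_space (carrier E) (nrm_dist E)"
proof
  fix x y z
  show "0 \<le> nrm_dist E x y"
    by (simp add: nrm_dist_def nrm_nonneg)
  show "nrm_dist E x y = nrm_dist E y x"
    by (simp add: nrm_dist_def nrm_minus_commute)
  assume x: "x \<in> carrier E" and y: "y \<in> carrier E"
  show "nrm_dist E x y = 0 \<longleftrightarrow> x = y"
    using x y by (simp add: nrm_dist_def nrm_eq_zero_iff minus_eq_zero_iff)
  assume z: "z \<in> carrier E"
  show "nrm_dist E x z \<le> nrm_dist E x y + nrm_dist E y z"
    using x y z by (simp add: nrm_dist_def nrm_minus_triangle)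
qed

text \<open>Eliminates the metric topology and the default value of \<open>nrm_dist\<close>: along
  sequences in the carrier, distance is the norm of a difference. Completeness is used and proved
  only in this form.\<close>

lemma mcomplete_iff:
  "Metric_space.mcomplete (carrier E) (nrm_dist E) \<longleftrightarrow>
    (\<forall>\<sigma>. (\<forall>n::nat. \<sigma> n \<in> carrier E) \<longrightarrow>
       (\<forall>\<epsilon>>0. \<exists>M. \<forall>n\<ge>M. \<forall>m\<ge>M. nrm E (\<sigma> n \<ominus> \<sigma> m) < \<epsilon>) \<longrightarrow>
       (\<exists>x\<in>carrier E. (\<lambda>n. nrm E (\<sigma> n \<ominus> x)) \<longlonglongrightarrow> 0))"
proof -
  interpret M: Metric_space "carrier E" "nrm_dist E" by (rule Metric_space_nrm_dist)
  have C: "M.MCauchy \<sigma> \<longleftrightarrow> (\<forall>n. \<sigma> n \<in> carrier E) \<and>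
      (\<forall>\<epsilon>>0. \<exists>M. \<forall>n\<ge>M. \<forall>m\<ge>M. nrm E (\<sigma> n \<ominus> \<sigma> m) < \<epsilon>)" for \<sigma> :: "nat \<Rightarrow> 'a"
  proof (cases "\<forall>n. \<sigma> n \<in> carrier E")
    case True
    hence "nrm_dist E (\<sigma> n) (\<sigma> m) = nrm E (\<sigma> n \<ominus> \<sigma> m)" for n m
      by (simp add: nrm_dist_def)
    thus ?thesis using True unfolding M.MCauchy_def by (simp add: image_subset_iff)
  next
    case False
    thus ?thesis unfolding M.MCauchy_def by blast
  qed
  have L: "limitin M.mtopology \<sigma> x sequentially \<longleftrightarrow>
      x \<in> carrier E \<and> (\<lambda>n. nrm E (\<sigma> n \<ominus> x)) \<longlonglongrightarrow> 0"
    if \<sigma>: "\<forall>n. \<sigma> n \<in> carrier E" for \<sigma> :: "nat \<Rightarrow> 'a" and x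
  proof (cases "x \<in> carrier E")
    case True
    hence "nrm_dist E (\<sigma> n) x = nrm E (\<sigma> n \<ominus> x)" for n
      using \<sigma> by (simp add: nrm_dist_def)
    thus ?thesis using True \<sigma> by (simp add: M.limitin_metric tendsto_iff nrm_nonneg)
  next
    case False
    thus ?thesis by (simp add: M.limitin_metric)
  qed
  show ?thesis unfolding M.mcomplete_def
    by (simp add: C L Bex_def imp_conjL[symmetric] cong: conj_cong)
qed

end

section \<open>GL-spaces via contractive functionals\<close>

text \<open>Neither norm exactly one nor extensionality is demanded, so the notion survives
  composition with embeddings and coordinate maps and summation over coordinates.
  \<open>GL_spaceI\<close> restores both properties.\<close>

definition contractive :: "'a normed_space \<Rightarrow> ('a \<Rightarrow> real) \<Rightarrow> bool" where
  "contractive E f \<longleftrightarrow>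
     (\<forall>x \<in> carrier E. \<forall>y \<in> carrier E. f (x \<oplus>\<^bsub>E\<^esub> y) = f x + f y) \<and>
     (\<forall>a. \<forall>x \<in> carrier E. f (a \<odot>\<^bsub>E\<^esub> x) = a * f x) \<and>
     (\<forall>x \<in> carrier E. \<bar>f x\<bar> \<le> nrm E x)"

text \<open>\<open>y\<close> is close to points \<open>z\<close> and \<open>-w\<close> of opposite (closed) slices of the ball of radius \<open>r\<close>;
  the variable radius makes the notion homogeneous.\<close>

definition near_slices ::
  "'a normed_space \<Rightarrow> ('a \<Rightarrow> real) \<Rightarrow> real \<Rightarrow> real \<Rightarrow> 'a \<Rightarrow> bool" where
  "near_slices E f \<epsilon> r y \<longleftrightarrow>
     (\<exists>z \<in> carrier E. \<exists>w \<in> carrier E. nrm E z \<le> r \<and> nrm E w \<le> r \<and>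
        (1 - \<epsilon>) * r \<le> f z \<and> (1 - \<epsilon>) * r \<le> f w \<and>
        nrm E (y \<ominus>\<^bsub>E\<^esub> z) + nrm E (y \<oplus>\<^bsub>E\<^esub> w) \<le> (2 + \<epsilon>) * r)"

context real_normed_space
begin

text \<open>A real supremum is an upper bound only of a bounded set; the constant in the definition
  of \<open>dual\<close> supplies boundedness on the ball. Homogeneity then does the rest, except at
  norm zero, where the same constant forces the value zero.\<close>

lemma dual_nrm_upper:
  assumes "f \<in> dual E" "x \<in> carrier E"
  shows "\<bar>f x\<bar> \<le> dual_nrm E f * nrm E x"
proof -
  have hom: "f (a \<odot> u) = a * f u" if "u \<in> carrier E" for a u
    using assms(1) that by (simp add: dual_def)
  obtain C where "\<forall>u \<in> carrier E. \<bar>f u\<bar> \<le> C * nrm E u"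
    using assms(1) by (auto simp: dual_def)
  hence C: "\<bar>f u\<bar> \<le> C * nrm E u" if "u \<in> carrier E" for u using that by simp
  have ball: "\<bar>f u\<bar> \<le> dual_nrm E f" if u: "u \<in> unit_ball E" for u
    unfolding dual_nrm_def
  proof (rule cSUP_upper[OF u])
    \<comment> \<open>The absolute value is taken because the sign of \<open>C\<close> is
      unknown.\<close>
    have "\<bar>f v\<bar> \<le> \<bar>C\<bar>" if "v \<in> unit_ball E" for v
    proof -
      have v: "v \<in> carrier E" "nrm E v \<le> 1" using that by (auto simp: unit_ball_def)
      have "\<bar>f v\<bar> \<le> C * nrm E v" using C v by simp
      also have "\<dots> \<le> \<bar>C\<bar> * nrm E v" by (simp add: mult_right_mono nrm_nonneg v)
      also have "\<dots> \<le> \<bar>C\<bar> * 1" using v by (intro mult_left_mono) auto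
      finally show ?thesis by simp
    qed
    thus "bdd_above ((\<lambda>x. \<bar>f x\<bar>) ` unit_ball E)" by (auto intro!: bdd_aboveI2)
  qed
  show ?thesis
  proof (cases "nrm E x = 0")
    case True
    thus ?thesis using C[OF assms(2)] by simp
  next
    case False
    hence pos: "nrm E x > 0" using nrm_nonneg[OF assms(2)] by simp
    have "(1 / nrm E x) \<odot> x \<in> unit_ball E"
      using assms(2) pos by (simp add: unit_ball_def nrm_smult)
    from ball[OF this] show ?thesis
      using assms(2) pos by (simp add: hom abs_mult field_simps)
  qed
qed

lemma GL_spaceD:
  assumes GL: "GL_space E" and x: "x \<in> unit_sphere E" and \<epsilon>: "\<epsilon> > 0"
  shows "\<exists>f. contractive E f \<and> 1 - \<epsilon> \<le> f x \<and> (\<forall>y \<in> unit_sphere E. near_slices E f \<epsilon> 1 y)"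
proof -
  from GL x \<epsilon> obtain f where f: "f \<in> dual_unit_sphere E" and fx: "x \<in> slice E f \<epsilon>"
    and D: "\<And>y. y \<in> unit_sphere E \<Longrightarrow> dist_to_set E y (slice E f \<epsilon>)
             + dist_to_set E y ((\<lambda>z. \<ominus> z) ` slice E f \<epsilon>) < 2 + \<epsilon>"
    unfolding GL_space_def by blast
  let ?S = "slice E f \<epsilon>"
  have S: "z \<in> carrier E" "nrm E z \<le> 1" "1 - \<epsilon> \<le> f z" if "z \<in> ?S" for z
    using that by (auto simp: slice_def unit_ball_def)
  have fd: "f \<in> dual E" and f1: "dual_nrm E f = 1"
    using f by (auto simp: dual_unit_sphere_def)
  have "contractive E f"
    unfolding contractive_def using fd dual_nrm_upper[OF fd] f1 by (auto simp: dual_def)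
  moreover have "near_slices E f \<epsilon> 1 y" if y: "y \<in> unit_sphere E" for y
  proof -
    have yc: "y \<in> carrier E" using y by (simp add: unit_sphere_def)
    \<comment> \<open>Half the slack in the strict inequality: both infima are then approached
      within \<open>\<eta>\<close> without exceeding \<open>2 + \<epsilon>\<close> in total.\<close>
    define \<eta> where "\<eta> = (2 + \<epsilon> - (dist_to_set E y ?S + dist_to_set E y ((\<lambda>z. \<ominus> z) ` ?S))) / 2"
    have \<eta>: "\<eta> > 0" using D[OF y] by (simp add: \<eta>_def)
    have near: "\<exists>z\<in>A. nrm_dist E y z < dist_to_set E y A + \<eta>" if "A \<noteq> {}" for A
      using that \<eta> cInf_lessD[of "nrm_dist E y ` A" "dist_to_set E y A + \<eta>"]
      unfolding dist_to_set_def by auto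
    obtain z where z: "z \<in> ?S" "nrm_dist E y z < dist_to_set E y ?S + \<eta>"
      using near[of ?S] fx by auto
    obtain w where w: "w \<in> ?S" "nrm_dist E y (\<ominus> w) < dist_to_set E y ((\<lambda>z. \<ominus> z) ` ?S) + \<eta>"
      using near[of "(\<lambda>z. \<ominus> z) ` ?S"] fx by auto
    have "nrm E (y \<ominus> z) + nrm E (y \<oplus> w) = nrm_dist E y z + nrm_dist E y (\<ominus> w)"
      using S[OF z(1)] S[OF w(1)] yc by (simp add: nrm_dist_def minus_a_inv)
    also have "\<dots> \<le> 2 + \<epsilon>" using z(2) w(2) unfolding \<eta>_def by (simp add: field_simps)
    finally show ?thesis
      unfolding near_slices_def using S[OF z(1)] S[OF w(1)] by auto
  qed
  ultimately show ?thesis using S[OF fx] by blast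
qed

text \<open>Contractive functionals suffice: normalising one that is positive somewhere enlarges
  its values where they are positive, hence also its slices.\<close>

lemma GL_spaceI:
  assumes "banach_space E"
    and ex: "\<And>x \<epsilon>. x \<in> unit_sphere E \<Longrightarrow> \<epsilon> > 0 \<Longrightarrow> \<epsilon> < 1 \<Longrightarrow>
      \<exists>f. contractive E f \<and> 1 - \<epsilon> \<le> f x \<and> (\<forall>y \<in> unit_sphere E. near_slices E f \<epsilon> 1 y)"
  shows "GL_space E"
  unfolding GL_space_def
proof (intro conjI ballI allI impI assms(1))
  fix x \<epsilon> assume x: "x \<in> unit_sphere E" and "(\<epsilon>::real) > 0"
  \<comment> \<open>Smaller than \<open>\<epsilon>\<close>, to turn the weak inequalities of
    \<open>near_slices\<close> into the strict ones of \<open>GL_space\<close>; smaller than 1, so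
    that \<open>f x > 0\<close> and \<open>f\<close> can be normalised.\<close>
  define \<epsilon>' where "\<epsilon>' = min (\<epsilon> / 2) (1 / 2)"
  have \<epsilon>': "\<epsilon>' > 0" "\<epsilon>' < 1" "\<epsilon>' < \<epsilon>" using \<open>\<epsilon> > 0\<close> by (auto simp: \<epsilon>'_def)
  obtain f where f: "contractive E f" and fx: "1 - \<epsilon>' \<le> f x"
    and near: "\<And>y. y \<in> unit_sphere E \<Longrightarrow> near_slices E f \<epsilon>' 1 y"
    using ex[OF x \<epsilon>'(1,2)] by blast
  have f_add: "f (u \<oplus> v) = f u + f v" if "u \<in> carrier E" "v \<in> carrier E" for u v
    using f that by (simp add: contractive_def)
  have f_smult: "f (a \<odot> u) = a * f u" if "u \<in> carrier E" for a u
    using f that by (simp add: contractive_def)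
  have f_le: "\<bar>f u\<bar> \<le> nrm E u" if "u \<in> carrier E" for u
    using f that by (simp add: contractive_def)
  have xc: "x \<in> carrier E" "nrm E x = 1" using x by (auto simp: unit_sphere_def)
  have xb: "x \<in> unit_ball E" using xc by (simp add: unit_ball_def)
  have bdd: "bdd_above ((\<lambda>u. \<bar>f u\<bar>) ` unit_ball E)"
  proof (rule bdd_aboveI2)
    fix u assume "u \<in> unit_ball E"
    thus "\<bar>f u\<bar> \<le> 1" using f_le[of u] by (simp add: unit_ball_def)
  qed
  define c where "c = (SUP u \<in> unit_ball E. \<bar>f u\<bar>)"
  have "\<bar>f x\<bar> \<le> c" unfolding c_def by (rule cSUP_upper[OF xb bdd])
  hence c0: "c > 0" using fx \<epsilon>' by linarith
  have c1: "c \<le> 1" unfolding c_def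
  proof (rule cSUP_least)
    show "unit_ball E \<noteq> {}" using xb by auto
    fix u assume "u \<in> unit_ball E"
    thus "\<bar>f u\<bar> \<le> 1" using f_le[of u] by (simp add: unit_ball_def)
  qed
  \<comment> \<open>\<open>c\<close> is the norm of \<open>f\<close>; the restriction to the carrier
    provides the extensionality required by \<open>dual\<close>.\<close>
  define g where "g = restrict (\<lambda>u. f u / c) (carrier E)"
  have g_eq: "g u = f u / c" if "u \<in> carrier E" for u using that by (simp add: g_def)
  have "g \<in> dual E"
    unfolding dual_def
  proof (intro CollectI conjI ballI allI exI[of _ "1 / c"])
    show "g \<in> extensional (carrier E)" by (simp add: g_def)
    fix u assume u: "u \<in> carrier E"
    show "\<bar>g u\<bar> \<le> 1 / c * nrm E u"
      using f_le[OF u] c0 u by (simp add: g_eq field_simps)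
    show "g (a \<odot> u) = a * g u" for a
      using u by (simp add: g_eq f_smult)
    fix v assume v: "v \<in> carrier E"
    show "g (u \<oplus> v) = g u + g v"
      using u v by (simp add: g_eq f_add add_divide_distrib)
  qed
  moreover have "dual_nrm E g = 1"
    unfolding dual_nrm_def
  proof (rule cSup_eq_non_empty)
    show "(\<lambda>u. \<bar>g u\<bar>) ` unit_ball E \<noteq> {}" using xb by auto
    fix s assume "s \<in> (\<lambda>u. \<bar>g u\<bar>) ` unit_ball E"
    then obtain u where u: "u \<in> unit_ball E" "s = \<bar>g u\<bar>" by auto
    have "\<bar>f u\<bar> \<le> c" unfolding c_def by (rule cSUP_upper[OF u(1) bdd])
    thus "s \<le> 1" using u c0 by (simp add: unit_ball_def g_eq)
  next
    fix s assume s: "\<And>t. t \<in> (\<lambda>u. \<bar>g u\<bar>) ` unit_ball E \<Longrightarrow> t \<le> s"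
    \<comment> \<open>A bound \<open>s\<close> for \<open>g\<close> on the ball is a bound
      \<open>s * c\<close> for \<open>f\<close>, whose supremum is \<open>c\<close>; cancelling
      \<open>c > 0\<close> gives \<open>1 \<le> s\<close>.\<close>
    have "c \<le> s * c" unfolding c_def
    proof (rule cSUP_least)
      show "unit_ball E \<noteq> {}" using xb by auto
      fix u assume u: "u \<in> unit_ball E"
      have "\<bar>g u\<bar> \<le> s" using s u by auto
      thus "\<bar>f u\<bar> \<le> s * (SUP u\<in>unit_ball E. \<bar>f u\<bar>)"
        using u c0 unfolding c_def[symmetric] by (simp add: unit_ball_def g_eq field_simps)
    qed
    thus "1 \<le> s" using c0 by simp
  qed
  ultimately have g: "g \<in> dual_unit_sphere E" by (simp add: dual_unit_sphere_def)
  have slice: "u \<in> slice E g \<epsilon>" if "u \<in> carrier E" "nrm E u \<le> 1" "1 - \<epsilon>' \<le> f u" for u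
  proof -
    have "f u \<le> f u / c" using that \<epsilon>' c0 c1
      by (simp add: pos_le_divide_eq mult_left_le)
    thus ?thesis using that \<epsilon>' by (simp add: slice_def unit_ball_def g_eq)
  qed
  \<comment> \<open>Thanks to its default value, \<open>nrm_dist\<close> is nonnegative off the
    carrier too, so the infimum is over a set bounded below for every \<open>A\<close>.\<close>
  have dist_le: "dist_to_set E y A \<le> nrm_dist E y u" if "u \<in> A" for y u A
    unfolding dist_to_set_def
    by (rule cINF_lower[OF _ that], rule bdd_belowI2[of _ 0]) (simp add: nrm_dist_def nrm_nonneg)
  show "\<exists>f\<in>dual_unit_sphere E. x \<in> slice E f \<epsilon> \<and>
        (\<forall>y\<in>unit_sphere E. dist_to_set E y (slice E f \<epsilon>)
             + dist_to_set E y ((\<lambda>z. \<ominus> z) ` slice E f \<epsilon>) < 2 + \<epsilon>)"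
  proof (intro bexI[OF _ g] conjI ballI)
    show "x \<in> slice E g \<epsilon>" using slice xc fx by simp
    fix y assume y: "y \<in> unit_sphere E"
    hence yc: "y \<in> carrier E" by (simp add: unit_sphere_def)
    obtain z w where zw: "z \<in> carrier E" "w \<in> carrier E" "nrm E z \<le> 1" "nrm E w \<le> 1"
        "1 - \<epsilon>' \<le> f z" "1 - \<epsilon>' \<le> f w" "nrm E (y \<ominus> z) + nrm E (y \<oplus> w) \<le> 2 + \<epsilon>'"
      using near[OF y] by (auto simp: near_slices_def)
    have "dist_to_set E y (slice E g \<epsilon>) \<le> nrm E (y \<ominus> z)"
      using dist_le[OF slice[of z], of y] zw yc by (simp add: nrm_dist_def)
    moreover have "dist_to_set E y ((\<lambda>z. \<ominus> z) ` slice E g \<epsilon>) \<le> nrm E (y \<oplus> w)"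
      using dist_le[of "\<ominus> w" "(\<lambda>z. \<ominus> z) ` slice E g \<epsilon>" y] slice[of w] zw yc
      by (simp add: nrm_dist_def minus_a_inv)
    ultimately show "dist_to_set E y (slice E g \<epsilon>)
             + dist_to_set E y ((\<lambda>z. \<ominus> z) ` slice E g \<epsilon>) < 2 + \<epsilon>"
      using zw(7) \<epsilon>' by linarith
  qed
qed

end

section \<open>Approximation by slices beyond the unit sphere\<close>

context real_normed_space
begin

lemma contractive_zero: "contractive E f \<Longrightarrow> f \<zero> = 0"
  unfolding contractive_def using zero_closed nrm_zero by fastforce

lemma near_slices_smult:
  assumes f: "contractive E f" and "near_slices E f \<epsilon> 1 y" "y \<in> carrier E" "0 \<le> t"
  shows "near_slices E f \<epsilon> t (t \<odot> y)"
proof -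
  obtain z w where zw: "z \<in> carrier E" "w \<in> carrier E" "nrm E z \<le> 1" "nrm E w \<le> 1"
      "1 - \<epsilon> \<le> f z" "1 - \<epsilon> \<le> f w" "nrm E (y \<ominus> z) + nrm E (y \<oplus> w) \<le> 2 + \<epsilon>"
    using assms(2) by (auto simp: near_slices_def)
  have f_smult: "f (t \<odot> u) = t * f u" if "u \<in> carrier E" for u
    using f that by (simp add: contractive_def)
  have "t \<odot> y \<ominus> t \<odot> z = t \<odot> (y \<ominus> z)"
    using zw assms(3) by (simp add: minus_eq_smult smult_add_right smult_smult)
  hence "nrm E (t \<odot> y \<ominus> t \<odot> z) + nrm E (t \<odot> y \<oplus> t \<odot> w)
      = t * (nrm E (y \<ominus> z) + nrm E (y \<oplus> w))"
    using zw assms(3,4) by (simp add: smult_add_right[symmetric] nrm_smult distrib_left)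
  also have "\<dots> \<le> t * (2 + \<epsilon>)" using zw assms(4) by (intro mult_left_mono) auto
  finally show ?thesis
    unfolding near_slices_def using zw assms(4)
    by (intro bexI[of _ "t \<odot> z"] bexI[of _ "t \<odot> w"])
      (auto simp: f_smult nrm_smult mult.commute[of _ t] intro: mult_left_le mult_left_mono)
qed

lemma nonzero_eq_smult_unit:
  assumes "x \<in> carrier E" "nrm E x \<noteq> 0"
  shows "(1 / nrm E x) \<odot> x \<in> unit_sphere E" "nrm E x \<odot> ((1 / nrm E x) \<odot> x) = x"
  using assms nrm_nonneg[OF assms(1)] by (simp_all add: unit_sphere_def nrm_smult smult_smult)

text \<open>The form in which the coordinates of a point of the \<open>l1\<close>-sum use the
  property: each at its own radius, which may be 0, in which case zero serves as both approximating
  points.\<close>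

lemma near_slices_nrm:
  assumes f: "contractive E f" and near: "\<And>y. y \<in> unit_sphere E \<Longrightarrow> near_slices E f \<epsilon> 1 y"
    and y: "y \<in> carrier E"
  shows "near_slices E f \<epsilon> (nrm E y) y"
proof (cases "nrm E y = 0")
  case True
  hence "y = \<zero>" using y nrm_eq_zero_iff by simp
  thus ?thesis unfolding near_slices_def
    by (intro bexI[of _ \<zero>]) (auto simp: contractive_zero[OF f])
next
  case False
  note u = nonzero_eq_smult_unit[OF y False]
  show ?thesis
    using near_slices_smult[OF f near[OF u(1)], of "nrm E y"] u y nrm_nonneg[OF y] by simp
qed

text \<open>Multiplying the inequality for the normalised point by the norm also makes it meaningful
  at \<open>x = \<zero>\<close>, the case that arises at the vanishing coordinates of a point of the
  \<open>l1\<close>-sum.\<close>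

lemma GL_spaceD_carrier:
  assumes GL: "GL_space E" and x: "x \<in> carrier E" and \<epsilon>: "\<epsilon> > 0"
  shows "\<exists>f. contractive E f \<and> (1 - \<epsilon>) * nrm E x \<le> f x \<and>
    (\<forall>y \<in> carrier E. near_slices E f \<epsilon> (nrm E y) y)"
proof (cases "nrm E x = 0")
  case False
  note u = nonzero_eq_smult_unit[OF x False]
  obtain f where f: "contractive E f" "1 - \<epsilon> \<le> f ((1 / nrm E x) \<odot> x)"
      "\<And>y. y \<in> unit_sphere E \<Longrightarrow> near_slices E f \<epsilon> 1 y"
    using GL_spaceD[OF GL u(1) \<epsilon>] by blast
  have "f ((1 / nrm E x) \<odot> x) = 1 / nrm E x * f x"
    using f(1) x unfolding contractive_def by blast
  moreover have "nrm E x > 0" using nrm_nonneg[OF x] False by simp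
  ultimately have "(1 - \<epsilon>) * nrm E x \<le> f x"
    using f(2) by (simp add: pos_le_divide_eq)
  thus ?thesis using f near_slices_nrm[OF f(1,3)] by blast
next
  case True
  hence x0: "x = \<zero>" using x nrm_eq_zero_iff by simp
  \<comment> \<open>At zero only the condition on \<open>y\<close> matters, so the functional of an
    arbitrary unit vector will do. A trivial space has no unit vector, and there the zero functional
    qualifies vacuously.\<close>
  have "\<exists>f. contractive E f \<and> (\<forall>y\<in>unit_sphere E. near_slices E f \<epsilon> 1 y)"
  proof (cases "unit_sphere E = {}")
    case True
    moreover have "contractive E (\<lambda>_. 0)" by (simp add: contractive_def nrm_nonneg)
    ultimately show ?thesis by blast
  qed (use GL_spaceD[OF GL _ \<epsilon>] in blast)
  then obtain f where f: "contractive E f" "\<And>y. y \<in> unit_sphere E \<Longrightarrow> near_slices E f \<epsilon> 1 y"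
    by blast
  thus ?thesis using near_slices_nrm[OF f] contractive_zero[OF f(1)] x0 by auto
qed

text \<open>A point of the ball is a convex combination of \<open>u\<close> and \<open>-u\<close> for some \<open>u\<close> in the sphere,
  and passing from \<open>u\<close> to \<open>-u\<close> just swaps the two approximating points.\<close>

lemma near_slices_ball:
  assumes f: "contractive E f" and near: "\<And>y. y \<in> unit_sphere E \<Longrightarrow> near_slices E f \<epsilon> 1 y"
    and ne: "unit_sphere E \<noteq> {}" and y: "y \<in> carrier E" "nrm E y \<le> 1"
  shows "near_slices E f \<epsilon> 1 y"
proof -
  define t where "t = nrm E y"
  have "\<exists>u \<in> unit_sphere E. y = t \<odot> u"
  proof (cases "nrm E y = 0")
    case True
    hence "y = \<zero>" using y nrm_eq_zero_iff by simp
    thus ?thesis using ne by (auto simp: unit_sphere_def t_def)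
  next
    case False
    from nonzero_eq_smult_unit[OF y(1) False] show ?thesis by (metis t_def)
  qed
  then obtain u where u: "u \<in> unit_sphere E" and yu: "y = t \<odot> u" by blast
  have uc: "u \<in> carrier E" using u by (simp add: unit_sphere_def)
  have t: "0 \<le> t" "t \<le> 1" using y nrm_nonneg by (auto simp: t_def)
  obtain z w where zw: "z \<in> carrier E" "w \<in> carrier E" "nrm E z \<le> 1" "nrm E w \<le> 1"
      "1 - \<epsilon> \<le> f z" "1 - \<epsilon> \<le> f w" "nrm E (u \<ominus> z) + nrm E (u \<oplus> w) \<le> 2 + \<epsilon>"
    using near[OF u] by (auto simp: near_slices_def)
  \<comment> \<open>The weights solve \<open>a + b = 1\<close> and \<open>a - b = t\<close>, so that
    \<open>y\<close> is the convex combination of \<open>u\<close> and \<open>-u\<close> with these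
    weights.\<close>
  define a b where "a = (1 + t) / 2" and "b = (1 - t) / 2"
  have ab: "0 \<le> a" "0 \<le> b" "a + b = 1" "t = a + - b"
    using t by (auto simp: a_def b_def field_simps)
  have yab: "y = a \<odot> u \<oplus> (- b) \<odot> u"
    using yu uc by (metis ab(4) smult_add_left)
  have comb: "a \<odot> p \<oplus> b \<odot> q \<in> carrier E \<and> nrm E (a \<odot> p \<oplus> b \<odot> q) \<le> 1 \<and>
      1 - \<epsilon> \<le> f (a \<odot> p \<oplus> b \<odot> q)"
    if "p \<in> carrier E" "q \<in> carrier E" "nrm E p \<le> 1" "nrm E q \<le> 1" "1 - \<epsilon> \<le> f p" "1 - \<epsilon> \<le> f q"
    for p q
  proof -
    have "nrm E (a \<odot> p \<oplus> b \<odot> q) \<le> a * nrm E p + b * nrm E q"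
      using nrm_triangle[of "a \<odot> p" "b \<odot> q"] that ab by (simp add: nrm_smult)
    also have "\<dots> \<le> a * 1 + b * 1" using that ab by (intro add_mono mult_left_mono) auto
    finally have 1: "nrm E (a \<odot> p \<oplus> b \<odot> q) \<le> 1" using ab by simp
    have "1 - \<epsilon> = a * (1 - \<epsilon>) + b * (1 - \<epsilon>)"
      using ab by (simp add: distrib_right[symmetric])
    also have "\<dots> \<le> a * f p + b * f q" using that ab by (intro add_mono mult_left_mono) auto
    also have "\<dots> = f (a \<odot> p \<oplus> b \<odot> q)" using that f by (simp add: contractive_def)
    finally show ?thesis using 1 that by simp
  qed
  have zc: "a \<odot> z \<oplus> b \<odot> w \<in> carrier E" and wc: "a \<odot> w \<oplus> b \<odot> z \<in> carrier E"
    using zw by auto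
  have "y \<ominus> (a \<odot> z \<oplus> b \<odot> w) = a \<odot> (u \<ominus> z) \<oplus> (- b) \<odot> (u \<oplus> w)"
    using zw uc by (simp add: yab minus_eq_smult smult_add_right smult_smult a_ac)
  hence 1: "nrm E (y \<ominus> (a \<odot> z \<oplus> b \<odot> w)) \<le> a * nrm E (u \<ominus> z) + b * nrm E (u \<oplus> w)"
    using nrm_triangle[of "a \<odot> (u \<ominus> z)" "(- b) \<odot> (u \<oplus> w)"] zw uc ab by (simp add: nrm_smult)
  have "y \<oplus> (a \<odot> w \<oplus> b \<odot> z) = a \<odot> (u \<oplus> w) \<oplus> (- b) \<odot> (u \<ominus> z)"
    using zw uc by (simp add: yab minus_eq_smult smult_add_right smult_smult a_ac)
  hence 2: "nrm E (y \<oplus> (a \<odot> w \<oplus> b \<odot> z)) \<le> a * nrm E (u \<oplus> w) + b * nrm E (u \<ominus> z)"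
    using nrm_triangle[of "a \<odot> (u \<oplus> w)" "(- b) \<odot> (u \<ominus> z)"] zw uc ab by (simp add: nrm_smult)
  \<comment> \<open>Because \<open>z\<close> and \<open>w\<close> exchange their weights in the two
    approximating points, each distance for \<open>u\<close> enters with total weight
    \<open>a + b = 1\<close>, and nothing is lost.\<close>
  have "a * nrm E (u \<ominus> z) + b * nrm E (u \<oplus> w) + (a * nrm E (u \<oplus> w) + b * nrm E (u \<ominus> z))
      = (a + b) * (nrm E (u \<ominus> z) + nrm E (u \<oplus> w))" by (simp add: algebra_simps)
  also have "\<dots> \<le> 2 + \<epsilon>" using zw ab by simp
  finally show ?thesis
    unfolding near_slices_def
    using 1 2 comb[OF zw(1,2,3,4,5,6)] comb[OF zw(2,1,4,3,6,5)]
    by (intro bexI[OF _ zc] bexI[OF _ wc]) auto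
qed

end

section \<open>Direct sums of Banach spaces\<close>

text \<open>In \<open>split_coord\<close>, the number \<open>s\<close> is \<open>0\<close> for the \<open>c\<^sub>0\<close>-norm and the norm of the remaining
  coordinates for the \<open>l\<^sub>1\<close>-norm.\<close>

locale sum_norm =
  fixes \<Lambda> :: "'i set" and C :: "('i \<Rightarrow> real) set" and N :: "('i \<Rightarrow> real) \<Rightarrow> real"
  assumes solid: "a \<in> C \<Longrightarrow> (\<And>i. i \<in> \<Lambda> \<Longrightarrow> \<bar>b i\<bar> \<le> \<bar>a i\<bar>) \<Longrightarrow> b \<in> C"
    and N_mono: "a \<in> C \<Longrightarrow> (\<And>i. i \<in> \<Lambda> \<Longrightarrow> \<bar>b i\<bar> \<le> \<bar>a i\<bar>) \<Longrightarrow> N b \<le> N a"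
    and add_mem: "a \<in> C \<Longrightarrow> b \<in> C \<Longrightarrow> (\<lambda>i. a i + b i) \<in> C"
    and N_triangle: "a \<in> C \<Longrightarrow> b \<in> C \<Longrightarrow> N (\<lambda>i. a i + b i) \<le> N a + N b"
    and scale_mem: "a \<in> C \<Longrightarrow> (\<lambda>i. c * a i) \<in> C"
    and N_scale: "a \<in> C \<Longrightarrow> N (\<lambda>i. c * a i) = \<bar>c\<bar> * N a"
    and coord_le: "a \<in> C \<Longrightarrow> i \<in> \<Lambda> \<Longrightarrow> \<bar>a i\<bar> \<le> N a"
    and zero_mem: "(\<lambda>_. 0) \<in> C"
    and single_mem: "i \<in> \<Lambda> \<Longrightarrow> (\<lambda>j. if j = i then c else 0) \<in> C"
    and N_single: "i \<in> \<Lambda> \<Longrightarrow> N (\<lambda>j. if j = i then c else 0) = \<bar>c\<bar>"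
    and Cauchy_limit_mem: "(\<And>n::nat. s n \<in> C) \<Longrightarrow>
      (\<And>\<epsilon>. \<epsilon> > 0 \<Longrightarrow> \<exists>M. \<forall>n\<ge>M. \<forall>m\<ge>M. N (\<lambda>i. s n i - s m i) < \<epsilon>) \<Longrightarrow>
      (\<And>i. i \<in> \<Lambda> \<Longrightarrow> (\<lambda>n. s n i) \<longlonglongrightarrow> b i) \<Longrightarrow> b \<in> C"
    and N_limit_le: "(\<And>n::nat. s n \<in> C) \<Longrightarrow> (\<And>n. N (s n) \<le> d) \<Longrightarrow>
      (\<And>i. i \<in> \<Lambda> \<Longrightarrow> (\<lambda>n. s n i) \<longlonglongrightarrow> b i) \<Longrightarrow> b \<in> C \<Longrightarrow> N b \<le> d"
    and split_coord: "a \<in> C \<Longrightarrow> (\<And>j. j \<in> \<Lambda> \<Longrightarrow> 0 \<le> a j) \<Longrightarrow> N a \<le> 1 \<Longrightarrow> i \<in> \<Lambda> \<Longrightarrow>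
      \<exists>s\<ge>0. (\<forall>b\<ge>0. b + s \<le> N (a(i := b))) \<and> N (a(i := 1)) \<le> 1 + s"
begin

lemma N_zero: "N (\<lambda>_. 0) = 0"
  using N_scale[OF zero_mem, of 0] by simp

lemma N_nonneg: "a \<in> C \<Longrightarrow> 0 \<le> N a"
  using N_mono[of a "\<lambda>_. 0"] N_zero by simp

end

section \<open>The direct sum as a normed space\<close>

locale banach_sum = sum_norm \<Lambda> C N
  for \<Lambda> :: "'i set" and C :: "('i \<Rightarrow> real) set" and N :: "('i \<Rightarrow> real) \<Rightarrow> real" +
  fixes E :: "'i \<Rightarrow> 'a normed_space"
  assumes banach: "i \<in> \<Lambda> \<Longrightarrow> banach_space (E i)"
begin

abbreviation D :: "('i \<Rightarrow> 'a) normed_space" where "D \<equiv> direct_sum \<Lambda> E C N"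

lemma normed: "i \<in> \<Lambda> \<Longrightarrow> real_normed_space (E i)"
  using banach banach_space.axioms(1) by blast

lemma carrier_D:
  "x \<in> carrier D \<longleftrightarrow> x \<in> (\<Pi>\<^sub>E i\<in>\<Lambda>. carrier (E i)) \<and> (\<lambda>i. nrm (E i) (x i)) \<in> C"
  by (simp add: direct_sum_def)

lemma coord_in_carrier: "x \<in> carrier D \<Longrightarrow> i \<in> \<Lambda> \<Longrightarrow> x i \<in> carrier (E i)"
  by (auto simp: carrier_D)

lemma norms_mem: "x \<in> carrier D \<Longrightarrow> (\<lambda>i. nrm (E i) (x i)) \<in> C"
  by (simp add: carrier_D)

lemma nrm_D: "nrm D x = N (\<lambda>i. nrm (E i) (x i))"
  and add_D: "x \<oplus>\<^bsub>D\<^esub> y = (\<lambda>i\<in>\<Lambda>. x i \<oplus>\<^bsub>E i\<^esub> y i)"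
  and smult_D: "a \<odot>\<^bsub>D\<^esub> x = (\<lambda>i\<in>\<Lambda>. a \<odot>\<^bsub>E i\<^esub> x i)"
  and zero_D: "\<zero>\<^bsub>D\<^esub> = (\<lambda>i\<in>\<Lambda>. \<zero>\<^bsub>E i\<^esub>)"
  by (simp_all add: direct_sum_def)

text \<open>By \<open>solid\<close>, a majorant of the norms suffices; for sums of vectors the
  triangle inequality offers nothing better.\<close>

lemma carrier_D_I:
  assumes "\<And>i. i \<in> \<Lambda> \<Longrightarrow> x i \<in> carrier (E i)" "x \<in> extensional \<Lambda>" "a \<in> C"
    "\<And>i. i \<in> \<Lambda> \<Longrightarrow> nrm (E i) (x i) \<le> a i"
  shows "x \<in> carrier D"
  unfolding carrier_D
proof
  show "x \<in> (\<Pi>\<^sub>E i\<in>\<Lambda>. carrier (E i))" using assms by (auto simp: PiE_def)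
  show "(\<lambda>i. nrm (E i) (x i)) \<in> C"
    using assms(3)
  proof (rule solid)
    fix i assume i: "i \<in> \<Lambda>"
    show "\<bar>nrm (E i) (x i)\<bar> \<le> \<bar>a i\<bar>"
      using assms(1,4)[OF i] real_normed_space.nrm_nonneg[OF normed[OF i]] by fastforce
  qed
qed

lemma nrm_D_le:
  assumes "\<And>i. i \<in> \<Lambda> \<Longrightarrow> x i \<in> carrier (E i)" "a \<in> C"
    "\<And>i. i \<in> \<Lambda> \<Longrightarrow> nrm (E i) (x i) \<le> a i"
  shows "nrm D x \<le> N a"
  unfolding nrm_D using assms(2)
proof (rule N_mono)
  fix i assume i: "i \<in> \<Lambda>"
  show "\<bar>nrm (E i) (x i)\<bar> \<le> \<bar>a i\<bar>"
    using assms(1,3)[OF i] real_normed_space.nrm_nonneg[OF normed[OF i]] by fastforce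
qed

lemma D_cong: "x \<in> carrier D \<Longrightarrow> y \<in> carrier D \<Longrightarrow> (\<And>i. i \<in> \<Lambda> \<Longrightarrow> x i = y i) \<Longrightarrow> x = y"
  by (auto simp: carrier_D intro: PiE_ext)

lemma add_in_D: "x \<in> carrier D \<Longrightarrow> y \<in> carrier D \<Longrightarrow> x \<oplus>\<^bsub>D\<^esub> y \<in> carrier D"
proof (rule carrier_D_I[OF _ _ add_mem[OF norms_mem norms_mem]])
  fix i assume xy: "x \<in> carrier D" "y \<in> carrier D" and i: "i \<in> \<Lambda>"
  interpret Ei: real_normed_space "E i" by (rule normed[OF i])
  show "(x \<oplus>\<^bsub>D\<^esub> y) i \<in> carrier (E i)" "nrm (E i) ((x \<oplus>\<^bsub>D\<^esub> y) i) \<le> nrm (E i) (x i) + nrm (E i) (y i)"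
    using coord_in_carrier[OF xy(1) i] coord_in_carrier[OF xy(2) i] i
    by (simp_all add: add_D Ei.nrm_triangle)
qed (auto simp: add_D)

lemma smult_in_D: "x \<in> carrier D \<Longrightarrow> a \<odot>\<^bsub>D\<^esub> x \<in> carrier D"
proof (rule carrier_D_I[OF _ _ scale_mem[OF norms_mem, of _ "\<bar>a\<bar>"]])
  fix i assume x: "x \<in> carrier D" and i: "i \<in> \<Lambda>"
  interpret Ei: real_normed_space "E i" by (rule normed[OF i])
  show "(a \<odot>\<^bsub>D\<^esub> x) i \<in> carrier (E i)" "nrm (E i) ((a \<odot>\<^bsub>D\<^esub> x) i) \<le> \<bar>a\<bar> * nrm (E i) (x i)"
    using coord_in_carrier[OF x i] i by (simp_all add: smult_D Ei.nrm_smult)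
qed (auto simp: smult_D)

lemma zero_in_D: "\<zero>\<^bsub>D\<^esub> \<in> carrier D"
proof (rule carrier_D_I[OF _ _ zero_mem])
  fix i assume i: "i \<in> \<Lambda>"
  interpret Ei: real_normed_space "E i" by (rule normed[OF i])
  show "\<zero>\<^bsub>D\<^esub> i \<in> carrier (E i)" "nrm (E i) (\<zero>\<^bsub>D\<^esub> i) \<le> 0" using i by (simp_all add: zero_D)
qed (auto simp: zero_D)

lemma abelian_group_D: "abelian_group D"
proof (rule abelian_groupI)
  note [simp] = add_in_D zero_in_D smult_in_D
  show "\<zero>\<^bsub>D\<^esub> \<in> carrier D" by simp
  fix x y assume x: "x \<in> carrier D" and y: "y \<in> carrier D"
  show "x \<oplus>\<^bsub>D\<^esub> y \<in> carrier D" using x y by simp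
  show "x \<oplus>\<^bsub>D\<^esub> y = y \<oplus>\<^bsub>D\<^esub> x"
  proof (rule D_cong)
    fix i assume i: "i \<in> \<Lambda>"
    interpret Ei: real_normed_space "E i" by (rule normed[OF i])
    show "(x \<oplus>\<^bsub>D\<^esub> y) i = (y \<oplus>\<^bsub>D\<^esub> x) i"
      using coord_in_carrier[OF x i] coord_in_carrier[OF y i] i by (simp add: add_D Ei.a_comm)
  qed (use x y in auto)
  show "(x \<oplus>\<^bsub>D\<^esub> y) \<oplus>\<^bsub>D\<^esub> z = x \<oplus>\<^bsub>D\<^esub> (y \<oplus>\<^bsub>D\<^esub> z)" if z: "z \<in> carrier D" for z
  proof (rule D_cong)
    fix i assume i: "i \<in> \<Lambda>"
    interpret Ei: real_normed_space "E i" by (rule normed[OF i])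
    show "((x \<oplus>\<^bsub>D\<^esub> y) \<oplus>\<^bsub>D\<^esub> z) i = (x \<oplus>\<^bsub>D\<^esub> (y \<oplus>\<^bsub>D\<^esub> z)) i"
      using coord_in_carrier[OF x i] coord_in_carrier[OF y i] coord_in_carrier[OF z i] i
      by (simp add: add_D Ei.a_assoc)
  qed (use x y z in auto)
  show "\<zero>\<^bsub>D\<^esub> \<oplus>\<^bsub>D\<^esub> x = x"
  proof (rule D_cong)
    fix i assume i: "i \<in> \<Lambda>"
    interpret Ei: real_normed_space "E i" by (rule normed[OF i])
    show "(\<zero>\<^bsub>D\<^esub> \<oplus>\<^bsub>D\<^esub> x) i = x i"
      using coord_in_carrier[OF x i] i by (simp add: add_D zero_D)
  qed (use x in auto)
  have "(-1) \<odot>\<^bsub>D\<^esub> x \<oplus>\<^bsub>D\<^esub> x = \<zero>\<^bsub>D\<^esub>"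
  proof (rule D_cong)
    fix i assume i: "i \<in> \<Lambda>"
    interpret Ei: real_normed_space "E i" by (rule normed[OF i])
    show "((-1) \<odot>\<^bsub>D\<^esub> x \<oplus>\<^bsub>D\<^esub> x) i = \<zero>\<^bsub>D\<^esub> i"
      using coord_in_carrier[OF x i] i Ei.smult_add_left[of "x i" "-1" 1]
      by (simp add: add_D zero_D smult_D)
  qed (use x in auto)
  thus "\<exists>y\<in>carrier D. y \<oplus>\<^bsub>D\<^esub> x = \<zero>\<^bsub>D\<^esub>" using x by (intro bexI[of _ "(-1) \<odot>\<^bsub>D\<^esub> x"]) auto
qed

lemma normed_D: "real_normed_space D"
proof (intro real_normed_space.intro moduleI real_normed_space_axioms.intro)
  note [simp] = add_in_D zero_in_D smult_in_D
  show "cring (ring_of_type_algebra :: real ring)" by (rule cring_from_type_algebra)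
  show "abelian_group D" by (rule abelian_group_D)
  fix x a b assume x: "x \<in> carrier D"
  show "a \<odot>\<^bsub>D\<^esub> x \<in> carrier D" using x by simp
  show "(a \<oplus>\<^bsub>ring_of_type_algebra\<^esub> b) \<odot>\<^bsub>D\<^esub> x = a \<odot>\<^bsub>D\<^esub> x \<oplus>\<^bsub>D\<^esub> b \<odot>\<^bsub>D\<^esub> x"
  proof (rule D_cong)
    fix i assume i: "i \<in> \<Lambda>"
    interpret Ei: real_normed_space "E i" by (rule normed[OF i])
    show "((a \<oplus>\<^bsub>ring_of_type_algebra\<^esub> b) \<odot>\<^bsub>D\<^esub> x) i = (a \<odot>\<^bsub>D\<^esub> x \<oplus>\<^bsub>D\<^esub> b \<odot>\<^bsub>D\<^esub> x) i"
      using coord_in_carrier[OF x i] i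
      by (simp add: add_D smult_D ring_of_type_algebra_def Ei.smult_add_left)
  qed (use x in auto)
  show "(a \<otimes>\<^bsub>ring_of_type_algebra\<^esub> b) \<odot>\<^bsub>D\<^esub> x = a \<odot>\<^bsub>D\<^esub> (b \<odot>\<^bsub>D\<^esub> x)"
  proof (rule D_cong)
    fix i assume i: "i \<in> \<Lambda>"
    interpret Ei: real_normed_space "E i" by (rule normed[OF i])
    show "((a \<otimes>\<^bsub>ring_of_type_algebra\<^esub> b) \<odot>\<^bsub>D\<^esub> x) i = (a \<odot>\<^bsub>D\<^esub> (b \<odot>\<^bsub>D\<^esub> x)) i"
      using coord_in_carrier[OF x i] i
      by (simp add: smult_D ring_of_type_algebra_def Ei.smult_smult)
  qed (use x in auto)
  show "\<one>\<^bsub>ring_of_type_algebra\<^esub> \<odot>\<^bsub>D\<^esub> x = x"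
  proof (rule D_cong)
    fix i assume i: "i \<in> \<Lambda>"
    interpret Ei: real_normed_space "E i" by (rule normed[OF i])
    show "(\<one>\<^bsub>ring_of_type_algebra\<^esub> \<odot>\<^bsub>D\<^esub> x) i = x i"
      using coord_in_carrier[OF x i] i by (simp add: smult_D ring_of_type_algebra_def)
  qed (use x in auto)
  show "0 \<le> nrm D x" unfolding nrm_D by (rule N_nonneg[OF norms_mem[OF x]])
  show "nrm D x = 0 \<longleftrightarrow> x = \<zero>\<^bsub>D\<^esub>"
  proof
    assume 0: "nrm D x = 0"
    show "x = \<zero>\<^bsub>D\<^esub>"
    proof (rule D_cong[OF x])
      fix i assume i: "i \<in> \<Lambda>"
      interpret Ei: real_normed_space "E i" by (rule normed[OF i])
      have "nrm (E i) (x i) = 0" using coord_le[OF norms_mem[OF x] i] 0 by (simp add: nrm_D)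
      thus "x i = \<zero>\<^bsub>D\<^esub> i"
        using Ei.nrm_eq_zero_iff coord_in_carrier[OF x i] i by (simp add: zero_D)
    qed auto
  next
    assume "x = \<zero>\<^bsub>D\<^esub>"
    have "nrm D x \<le> N (\<lambda>_. 0)"
    proof (rule nrm_D_le[OF _ zero_mem])
      fix i assume i: "i \<in> \<Lambda>"
      interpret Ei: real_normed_space "E i" by (rule normed[OF i])
      show "x i \<in> carrier (E i)" "nrm (E i) (x i) \<le> 0"
        using \<open>x = \<zero>\<^bsub>D\<^esub>\<close> i by (simp_all add: zero_D)
    qed
    thus "nrm D x = 0" using N_zero N_nonneg[OF norms_mem[OF x]] by (simp add: nrm_D)
  qed
  show "nrm D (a \<odot>\<^bsub>D\<^esub> x) = \<bar>a\<bar> * nrm D x"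
  proof -
    have eq: "nrm (E i) ((a \<odot>\<^bsub>D\<^esub> x) i) = \<bar>a\<bar> * nrm (E i) (x i)" if i: "i \<in> \<Lambda>" for i
      using real_normed_space.nrm_smult[OF normed[OF i] coord_in_carrier[OF x i]] i
      by (simp add: smult_D)
    \<comment> \<open>The two families agree on \<open>\<Lambda>\<close> but possibly not elsewhere;
      monotonicity in both directions shows that \<open>N\<close> does not see the
      difference.\<close>
    have "N (\<lambda>i. nrm (E i) ((a \<odot>\<^bsub>D\<^esub> x) i)) = N (\<lambda>i. \<bar>a\<bar> * nrm (E i) (x i))"
      by (intro antisym N_mono norms_mem scale_mem smult_in_D x) (simp_all add: eq)
    thus ?thesis by (simp add: nrm_D N_scale[OF norms_mem[OF x]])
  qed
  fix y assume y: "y \<in> carrier D"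
  show "a \<odot>\<^bsub>D\<^esub> (x \<oplus>\<^bsub>D\<^esub> y) = a \<odot>\<^bsub>D\<^esub> x \<oplus>\<^bsub>D\<^esub> a \<odot>\<^bsub>D\<^esub> y"
  proof (rule D_cong)
    fix i assume i: "i \<in> \<Lambda>"
    interpret Ei: real_normed_space "E i" by (rule normed[OF i])
    show "(a \<odot>\<^bsub>D\<^esub> (x \<oplus>\<^bsub>D\<^esub> y)) i = (a \<odot>\<^bsub>D\<^esub> x \<oplus>\<^bsub>D\<^esub> a \<odot>\<^bsub>D\<^esub> y) i"
      using coord_in_carrier[OF x i] coord_in_carrier[OF y i] i
      by (simp add: add_D smult_D Ei.smult_add_right)
  qed (use x y in auto)
  have "nrm D (x \<oplus>\<^bsub>D\<^esub> y) \<le> N (\<lambda>i. nrm (E i) (x i) + nrm (E i) (y i))"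
  proof (rule nrm_D_le)
    show "(\<lambda>i. nrm (E i) (x i) + nrm (E i) (y i)) \<in> C" by (intro add_mem norms_mem x y)
    fix i assume i: "i \<in> \<Lambda>"
    interpret Ei: real_normed_space "E i" by (rule normed[OF i])
    show "(x \<oplus>\<^bsub>D\<^esub> y) i \<in> carrier (E i)"
      "nrm (E i) ((x \<oplus>\<^bsub>D\<^esub> y) i) \<le> nrm (E i) (x i) + nrm (E i) (y i)"
      using coord_in_carrier[OF x i] coord_in_carrier[OF y i] i
      by (simp_all add: add_D Ei.nrm_triangle)
  qed
  also have "\<dots> \<le> nrm D x + nrm D y" unfolding nrm_D by (intro N_triangle norms_mem x y)
  finally show "nrm D (x \<oplus>\<^bsub>D\<^esub> y) \<le> nrm D x + nrm D y" .
qed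

end

section \<open>Completeness of the direct sum\<close>

context banach_sum
begin

lemma N_cong:
  assumes "a \<in> C" "\<And>i. i \<in> \<Lambda> \<Longrightarrow> a i = b i"
  shows "N a = N b"
proof (rule antisym)
  have "b \<in> C" using solid[OF assms(1), of b] assms(2) by simp
  thus "N a \<le> N b" using N_mono assms(2) by simp
  show "N b \<le> N a" using N_mono[OF assms(1), of b] assms(2) by simp
qed

lemma minus_in_D: "x \<in> carrier D \<Longrightarrow> y \<in> carrier D \<Longrightarrow> x \<ominus>\<^bsub>D\<^esub> y \<in> carrier D"
  using real_normed_space.minus_eq_smult[OF normed_D] add_in_D smult_in_D by simp

text \<open>Subtraction is not a field of \<open>direct_sum\<close> but derives from its additive
  inverse; writing it as addition of the multiple by -1 on both sides makes it
  coordinatewise.\<close>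

lemma minus_D:
  assumes "x \<in> carrier D" "y \<in> carrier D" "i \<in> \<Lambda>"
  shows "(x \<ominus>\<^bsub>D\<^esub> y) i = x i \<ominus>\<^bsub>E i\<^esub> y i"
  using real_normed_space.minus_eq_smult[OF normed_D assms(1,2)]
    real_normed_space.minus_eq_smult[OF normed[OF assms(3)]
      coord_in_carrier[OF assms(1,3)] coord_in_carrier[OF assms(2,3)]] assms(3)
  by (simp add: add_D smult_D)

lemma nrm_coord_le: "x \<in> carrier D \<Longrightarrow> i \<in> \<Lambda> \<Longrightarrow> nrm (E i) (x i) \<le> nrm D x"
  using coord_le[OF norms_mem, of x i] by (simp add: nrm_D)

text \<open>The limit is formed coordinatewise. As the axioms of \<open>sum_norm\<close> only know
  real families, they are applied to the families of norms of the terms, for membership of the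
  limit, and of the differences, for convergence.\<close>

lemma banach_D: "banach_space D"
proof (intro banach_space.intro normed_D banach_space_axioms.intro)
  show "Metric_space.mcomplete (carrier D) (nrm_dist D)"
    unfolding real_normed_space.mcomplete_iff[OF normed_D]
  proof (intro allI impI)
    fix \<sigma> :: "nat \<Rightarrow> 'i \<Rightarrow> 'a"
    assume "\<forall>n. \<sigma> n \<in> carrier D"
      and Cauchy: "\<forall>\<epsilon>>0. \<exists>M. \<forall>n\<ge>M. \<forall>m\<ge>M. nrm D (\<sigma> n \<ominus>\<^bsub>D\<^esub> \<sigma> m) < \<epsilon>"
    hence \<sigma>: "\<sigma> n \<in> carrier D" for n by blast
    have "\<forall>i\<in>\<Lambda>. \<exists>l. l \<in> carrier (E i) \<and> (\<lambda>n. nrm (E i) (\<sigma> n i \<ominus>\<^bsub>E i\<^esub> l)) \<longlonglongrightarrow> 0"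
    proof
      fix i assume i: "i \<in> \<Lambda>"
      have le: "nrm (E i) (\<sigma> n i \<ominus>\<^bsub>E i\<^esub> \<sigma> m i) \<le> nrm D (\<sigma> n \<ominus>\<^bsub>D\<^esub> \<sigma> m)" for n m
        using nrm_coord_le[OF minus_in_D[OF \<sigma> \<sigma>] i, of n m] i by (simp add: minus_D \<sigma>)
      have "\<forall>\<epsilon>>0. \<exists>M. \<forall>n\<ge>M. \<forall>m\<ge>M. nrm (E i) (\<sigma> n i \<ominus>\<^bsub>E i\<^esub> \<sigma> m i) < \<epsilon>"
        using Cauchy by (meson le le_less_trans)
      moreover have "\<forall>n. \<sigma> n i \<in> carrier (E i)" using coord_in_carrier[OF \<sigma> i] by blast
      ultimately have "\<exists>l\<in>carrier (E i). (\<lambda>n. nrm (E i) (\<sigma> n i \<ominus>\<^bsub>E i\<^esub> l)) \<longlonglongrightarrow> 0"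
        using banach_space.complete[OF banach[OF i]]
        unfolding real_normed_space.mcomplete_iff[OF normed[OF i]]
        by (elim allE[of _ "\<lambda>n. \<sigma> n i"]) simp
      thus "\<exists>l. l \<in> carrier (E i) \<and> (\<lambda>n. nrm (E i) (\<sigma> n i \<ominus>\<^bsub>E i\<^esub> l)) \<longlonglongrightarrow> 0" by blast
    qed
    from bchoice[OF this] obtain l where
      l: "\<And>i. i \<in> \<Lambda> \<Longrightarrow> l i \<in> carrier (E i)"
        "\<And>i. i \<in> \<Lambda> \<Longrightarrow> (\<lambda>n. nrm (E i) (\<sigma> n i \<ominus>\<^bsub>E i\<^esub> l i)) \<longlonglongrightarrow> 0" by blast
    define x where "x = restrict l \<Lambda>"
    have xi: "x i = l i" if "i \<in> \<Lambda>" for i using that by (simp add: x_def)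
    \<comment> \<open>By the reverse triangle inequality in each coordinate, the families of norms
      of \<open>\<sigma> n\<close> form a Cauchy sequence for \<open>N\<close> whenever
      \<open>\<sigma>\<close> is Cauchy.\<close>
    have "(\<lambda>i. nrm (E i) (x i)) \<in> C"
    proof (rule Cauchy_limit_mem[where s = "\<lambda>n i. nrm (E i) (\<sigma> n i)"])
      show "(\<lambda>i. nrm (E i) (\<sigma> n i)) \<in> C" for n by (rule norms_mem[OF \<sigma>])
      fix \<epsilon> :: real assume "\<epsilon> > 0"
      then obtain M where M: "\<And>n m. n \<ge> M \<Longrightarrow> m \<ge> M \<Longrightarrow> nrm D (\<sigma> n \<ominus>\<^bsub>D\<^esub> \<sigma> m) < \<epsilon>"
        using Cauchy by blast
      have "N (\<lambda>i. nrm (E i) (\<sigma> n i) - nrm (E i) (\<sigma> m i)) \<le> nrm D (\<sigma> n \<ominus>\<^bsub>D\<^esub> \<sigma> m)" for n m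
        unfolding nrm_D
      proof (rule N_mono[OF norms_mem[OF minus_in_D[OF \<sigma> \<sigma>]]])
        fix i assume i: "i \<in> \<Lambda>"
        interpret Ei: real_normed_space "E i" by (rule normed[OF i])
        show "\<bar>nrm (E i) (\<sigma> n i) - nrm (E i) (\<sigma> m i)\<bar> \<le> \<bar>nrm (E i) ((\<sigma> n \<ominus>\<^bsub>D\<^esub> \<sigma> m) i)\<bar>"
          using Ei.nrm_diff_abs[OF coord_in_carrier[OF \<sigma> i] coord_in_carrier[OF \<sigma> i], of n m] i
          by (simp add: minus_D \<sigma>)
      qed
      thus "\<exists>M. \<forall>n\<ge>M. \<forall>m\<ge>M. N (\<lambda>i. nrm (E i) (\<sigma> n i) - nrm (E i) (\<sigma> m i)) < \<epsilon>"
        using M by (meson le_less_trans)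
    next
      fix i assume i: "i \<in> \<Lambda>"
      interpret Ei: real_normed_space "E i" by (rule normed[OF i])
      show "(\<lambda>n. nrm (E i) (\<sigma> n i)) \<longlonglongrightarrow> nrm (E i) (x i)"
      proof (rule Lim_null_comparison[THEN LIM_zero_cancel])
        show "\<forall>\<^sub>F n in sequentially. norm (nrm (E i) (\<sigma> n i) - nrm (E i) (x i))
            \<le> nrm (E i) (\<sigma> n i \<ominus>\<^bsub>E i\<^esub> l i)"
          using Ei.nrm_diff_abs[OF coord_in_carrier[OF \<sigma> i] l(1)[OF i]] i
          by (simp add: xi)
      qed (rule l(2)[OF i])
    qed
    hence x: "x \<in> carrier D" using l(1) by (auto simp: carrier_D x_def)
    have "(\<lambda>n. nrm D (\<sigma> n \<ominus>\<^bsub>D\<^esub> x)) \<longlonglongrightarrow> 0"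
    proof (rule LIMSEQ_I)
      fix \<epsilon> :: real assume \<epsilon>: "\<epsilon> > 0"
      then obtain M where M: "\<And>n m. n \<ge> M \<Longrightarrow> m \<ge> M \<Longrightarrow> nrm D (\<sigma> n \<ominus>\<^bsub>D\<^esub> \<sigma> m) < \<epsilon> / 2"
        using Cauchy[rule_format, of "\<epsilon> / 2"] by auto
      \<comment> \<open>With \<open>n\<close> fixed, the second index of the Cauchy condition tends
        to infinity. It is shifted by \<open>M\<close> because \<open>N_limit_le\<close> wants the
        bound for every term; the half leaves room for a strict inequality after the limit.\<close>
      have "nrm D (\<sigma> n \<ominus>\<^bsub>D\<^esub> x) \<le> \<epsilon> / 2" if n: "n \<ge> M" for n
        unfolding nrm_D
      proof (rule N_limit_le[where s = "\<lambda>m i. nrm (E i) ((\<sigma> n \<ominus>\<^bsub>D\<^esub> \<sigma> (m + M)) i)"])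
        show "(\<lambda>i. nrm (E i) ((\<sigma> n \<ominus>\<^bsub>D\<^esub> \<sigma> (m + M)) i)) \<in> C" for m
          by (intro norms_mem minus_in_D \<sigma>)
        show "N (\<lambda>i. nrm (E i) ((\<sigma> n \<ominus>\<^bsub>D\<^esub> \<sigma> (m + M)) i)) \<le> \<epsilon> / 2" for m
          using M[OF n, of "m + M"] by (simp add: nrm_D)
        show "(\<lambda>i. nrm (E i) ((\<sigma> n \<ominus>\<^bsub>D\<^esub> x) i)) \<in> C"
          by (intro norms_mem minus_in_D \<sigma> x)
        fix i assume i: "i \<in> \<Lambda>"
        interpret Ei: real_normed_space "E i" by (rule normed[OF i])
        have \<sigma>i: "\<sigma> m i \<in> carrier (E i)" for m by (rule coord_in_carrier[OF \<sigma> i])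
        show "(\<lambda>m. nrm (E i) ((\<sigma> n \<ominus>\<^bsub>D\<^esub> \<sigma> (m + M)) i))
            \<longlonglongrightarrow> nrm (E i) ((\<sigma> n \<ominus>\<^bsub>D\<^esub> x) i)"
        proof (rule Lim_null_comparison[THEN LIM_zero_cancel])
          have "\<bar>nrm (E i) (\<sigma> n i \<ominus>\<^bsub>E i\<^esub> \<sigma> (m + M) i) - nrm (E i) (\<sigma> n i \<ominus>\<^bsub>E i\<^esub> l i)\<bar>
              \<le> nrm (E i) (\<sigma> (m + M) i \<ominus>\<^bsub>E i\<^esub> l i)" for m
            using Ei.nrm_minus_triangle[OF \<sigma>i l(1)[OF i] \<sigma>i, of n "m + M"]
              Ei.nrm_minus_triangle[OF \<sigma>i \<sigma>i l(1)[OF i], of n "m + M"]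
              Ei.nrm_minus_commute[OF \<sigma>i l(1)[OF i], of "m + M"] by linarith
          thus "\<forall>\<^sub>F m in sequentially. norm (nrm (E i) ((\<sigma> n \<ominus>\<^bsub>D\<^esub> \<sigma> (m + M)) i)
              - nrm (E i) ((\<sigma> n \<ominus>\<^bsub>D\<^esub> x) i)) \<le> nrm (E i) (\<sigma> (m + M) i \<ominus>\<^bsub>E i\<^esub> l i)"
            using i x by (simp add: minus_D \<sigma> xi)
          show "(\<lambda>m. nrm (E i) (\<sigma> (m + M) i \<ominus>\<^bsub>E i\<^esub> l i)) \<longlonglongrightarrow> 0"
            using LIMSEQ_ignore_initial_segment[OF l(2)[OF i], of M] .
        qed
      qed
      hence "\<forall>n\<ge>M. norm (nrm D (\<sigma> n \<ominus>\<^bsub>D\<^esub> x) - 0) < \<epsilon>"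
        using \<epsilon> real_normed_space.nrm_nonneg[OF normed_D minus_in_D[OF \<sigma> x]]
        by (fastforce intro: le_less_trans)
      thus "\<exists>M. \<forall>n\<ge>M. norm (nrm D (\<sigma> n \<ominus>\<^bsub>D\<^esub> x) - 0) < \<epsilon>" by blast
    qed
    thus "\<exists>x\<in>carrier D. (\<lambda>n. nrm D (\<sigma> n \<ominus>\<^bsub>D\<^esub> x)) \<longlonglongrightarrow> 0" using x by blast
  qed
qed

section \<open>From the sum to a component\<close>

definition embed :: "'i \<Rightarrow> 'a \<Rightarrow> 'i \<Rightarrow> 'a" where
  "embed i x = (\<lambda>j\<in>\<Lambda>. if j = i then x else \<zero>\<^bsub>E j\<^esub>)"

lemma zero_in_carrier [simp]: "i \<in> \<Lambda> \<Longrightarrow> \<zero>\<^bsub>E i\<^esub> \<in> carrier (E i)"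
  and nrm_zero_coord [simp]: "i \<in> \<Lambda> \<Longrightarrow> nrm (E i) \<zero>\<^bsub>E i\<^esub> = 0"
proof -
  assume i: "i \<in> \<Lambda>"
  interpret Ei: real_normed_space "E i" by (rule normed[OF i])
  show "\<zero>\<^bsub>E i\<^esub> \<in> carrier (E i)" "nrm (E i) \<zero>\<^bsub>E i\<^esub> = 0" by simp_all
qed

lemma embed_in_D:
  assumes "i \<in> \<Lambda>" "x \<in> carrier (E i)"
  shows "embed i x \<in> carrier D"
  by (rule carrier_D_I[OF _ _ single_mem[OF assms(1), of "nrm (E i) x"]])
    (use assms in \<open>auto simp: embed_def\<close>)

lemma nrm_embed:
  assumes "i \<in> \<Lambda>" "x \<in> carrier (E i)"
  shows "nrm D (embed i x) = nrm (E i) x"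
proof -
  have "nrm D (embed i x) = N (\<lambda>j. if j = i then nrm (E i) x else 0)"
    unfolding nrm_D by (rule N_cong[OF norms_mem[OF embed_in_D[OF assms]]]) (simp add: embed_def)
  thus ?thesis
    using N_single[OF assms(1)] real_normed_space.nrm_nonneg[OF normed[OF assms(1)] assms(2)] by simp
qed

lemma embed_add:
  assumes i: "i \<in> \<Lambda>" and x: "x \<in> carrier (E i)" and y: "y \<in> carrier (E i)"
  shows "embed i (x \<oplus>\<^bsub>E i\<^esub> y) = embed i x \<oplus>\<^bsub>D\<^esub> embed i y"
proof -
  interpret Ei: real_normed_space "E i" by (rule normed[OF i])
  show ?thesis
  proof (rule D_cong)
    fix j assume j: "j \<in> \<Lambda>"
    interpret Ej: real_normed_space "E j" by (rule normed[OF j])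
    show "embed i (x \<oplus>\<^bsub>E i\<^esub> y) j = (embed i x \<oplus>\<^bsub>D\<^esub> embed i y) j"
      using j by (simp add: embed_def add_D)
  qed (use assms in \<open>auto intro!: add_in_D embed_in_D\<close>)
qed

lemma embed_smult:
  assumes i: "i \<in> \<Lambda>" and x: "x \<in> carrier (E i)"
  shows "embed i (a \<odot>\<^bsub>E i\<^esub> x) = a \<odot>\<^bsub>D\<^esub> embed i x"
proof -
  interpret Ei: real_normed_space "E i" by (rule normed[OF i])
  show ?thesis
  proof (rule D_cong)
    fix j assume j: "j \<in> \<Lambda>"
    interpret Ej: real_normed_space "E j" by (rule normed[OF j])
    show "embed i (a \<odot>\<^bsub>E i\<^esub> x) j = (a \<odot>\<^bsub>D\<^esub> embed i x) j"
      using j by (simp add: embed_def smult_D)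
  qed (use assms in \<open>auto intro!: smult_in_D embed_in_D\<close>)
qed

lemma contractive_embed:
  assumes f: "contractive D f" and i: "i \<in> \<Lambda>"
  shows "contractive (E i) (\<lambda>x. f (embed i x))"
  using f i unfolding contractive_def
  by (auto simp: embed_add embed_smult embed_in_D nrm_embed[symmetric])

lemma upd_in_D:
  assumes p: "p \<in> carrier D" and i: "i \<in> \<Lambda>" and x: "x \<in> carrier (E i)"
  shows "p(i := x) \<in> carrier D"
proof (rule carrier_D_I[OF _ _ add_mem[OF norms_mem[OF p] single_mem[OF i, of "nrm (E i) x"]]])
  show "p(i := x) \<in> extensional \<Lambda>"
    using p i by (auto simp: carrier_D PiE_def extensional_def)
  fix j assume j: "j \<in> \<Lambda>"
  show "(p(i := x)) j \<in> carrier (E j)" using coord_in_carrier[OF p j] x by simp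
  show "nrm (E j) ((p(i := x)) j) \<le> nrm (E j) (p j) + (if j = i then nrm (E i) x else 0)"
    using real_normed_space.nrm_nonneg[OF normed[OF j] coord_in_carrier[OF p j]] by auto
qed

lemma nrm_upd:
  assumes p: "p \<in> carrier D" and i: "i \<in> \<Lambda>" and x: "x \<in> carrier (E i)"
  shows "nrm D (p(i := x)) = N ((\<lambda>j. nrm (E j) (p j))(i := nrm (E i) x))"
  unfolding nrm_D by (rule N_cong[OF norms_mem[OF upd_in_D[OF assms]]]) simp

text \<open>What the projection to the \<open>i\<close>-th coordinate loses is compensated by adding \<open>s\<close> times
  the point \<open>x\<close>, at which the functional is almost maximal.\<close>

lemma slice_point_of_component:
  assumes f: "contractive D f" and i: "i \<in> \<Lambda>" and \<epsilon>: "0 \<le> \<epsilon>"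
    and x: "x \<in> unit_sphere (E i)" and fx: "1 - \<epsilon> \<le> f (embed i x)"
    and p: "p \<in> carrier D" "nrm D p \<le> 1" "1 - \<epsilon> \<le> f p"
  shows "\<exists>q \<in> carrier (E i). nrm (E i) q \<le> 1 \<and> 1 - 3 * \<epsilon> \<le> f (embed i q) \<and>
    (\<forall>v \<in> carrier (E i). nrm (E i) (v \<ominus>\<^bsub>E i\<^esub> q) \<le> nrm D (embed i v \<ominus>\<^bsub>D\<^esub> p) \<and>
       nrm (E i) (v \<oplus>\<^bsub>E i\<^esub> q) \<le> nrm D (embed i v \<oplus>\<^bsub>D\<^esub> p))"
proof -
  interpret Ei: real_normed_space "E i" by (rule normed[OF i])
  have xc: "x \<in> carrier (E i)" and x1: "nrm (E i) x = 1" using x by (auto simp: unit_sphere_def)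
  have pi: "p i \<in> carrier (E i)" by (rule coord_in_carrier[OF p(1) i])
  define a where "a = (\<lambda>j. nrm (E j) (p j))"
  have "0 \<le> a j" if "j \<in> \<Lambda>" for j
    using real_normed_space.nrm_nonneg[OF normed coord_in_carrier] that p by (simp add: a_def)
  moreover have "a \<in> C" unfolding a_def by (rule norms_mem[OF p(1)])
  moreover have Na: "N a \<le> 1" using p(2) by (simp add: nrm_D a_def)
  ultimately obtain s where s: "s \<ge> 0" "\<And>b. b \<ge> 0 \<Longrightarrow> b + s \<le> N (a(i := b))" "N (a(i := 1)) \<le> 1 + s"
    using split_coord[of a i] i by blast
  \<comment> \<open>Inserting its own coordinate leaves \<open>a\<close> unchanged, so the splitting
    inequality can be compared with \<open>N a \<le> 1\<close>.\<close>
  have s_le: "nrm (E i) (p i) + s \<le> 1"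
    using s(2)[of "a i"] Na Ei.nrm_nonneg[OF pi] by (simp add: fun_upd_triv) (simp add: a_def)
  have s1: "s \<le> 1" using s_le Ei.nrm_nonneg[OF pi] by simp
  have f_add: "f (u \<oplus>\<^bsub>D\<^esub> v) = f u + f v" if "u \<in> carrier D" "v \<in> carrier D" for u v
    using f that by (simp add: contractive_def)
  define q where "q = p i \<oplus>\<^bsub>E i\<^esub> s \<odot>\<^bsub>E i\<^esub> x"
  have q: "q \<in> carrier (E i)" using pi xc by (simp add: q_def)
  have "nrm (E i) q \<le> 1"
    using Ei.nrm_triangle[OF pi Ei.smult_in_carrier[OF xc, of s]] s_le s(1) xc
    by (simp add: q_def Ei.nrm_smult x1)
  moreover have "1 - 3 * \<epsilon> \<le> f (embed i q)"
  proof -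
    \<comment> \<open>Exchanging the \<open>i\<close>-th coordinates of \<open>p\<close> and
      \<open>embed i x\<close> keeps the sum. On the left both values of \<open>f\<close> are nearly
      1, on the right the first is at most \<open>1 + s\<close>, which leaves a lower bound for the
      value at the projection of \<open>p\<close>.\<close>
    have "p \<oplus>\<^bsub>D\<^esub> embed i x = p(i := x) \<oplus>\<^bsub>D\<^esub> embed i (p i)"
    proof (rule D_cong)
      fix j assume j: "j \<in> \<Lambda>"
      interpret Ej: real_normed_space "E j" by (rule normed[OF j])
      show "(p \<oplus>\<^bsub>D\<^esub> embed i x) j = (p(i := x) \<oplus>\<^bsub>D\<^esub> embed i (p i)) j"
        using j pi xc by (simp add: embed_def add_D Ei.a_comm)
    qed (use i p pi xc in \<open>auto intro!: add_in_D embed_in_D upd_in_D\<close>)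
    hence "f p + f (embed i x) = f (p(i := x)) + f (embed i (p i))"
      using f_add[of p "embed i x"] f_add[of "p(i := x)" "embed i (p i)"] i p pi xc
      by (simp add: embed_in_D upd_in_D)
    moreover have "f (p(i := x)) \<le> 1 + s"
    proof -
      have "\<bar>f (p(i := x))\<bar> \<le> nrm D (p(i := x))"
        using f upd_in_D[OF p(1) i xc] by (simp add: contractive_def)
      thus ?thesis using s(3) nrm_upd[OF p(1) i xc] by (simp add: x1 a_def)
    qed
    ultimately have "1 - 2 * \<epsilon> - s \<le> f (embed i (p i))" using p(3) fx by linarith
    moreover have "f (embed i q) = f (embed i (p i)) + s * f (embed i x)"
      using contractive_embed[OF f i] pi xc by (simp add: q_def contractive_def)
    moreover have "s * (1 - \<epsilon>) \<le> s * f (embed i x)" using fx s(1) by (rule mult_left_mono)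
    \<comment> \<open>The third loss of \<open>\<epsilon>\<close>: \<open>p\<close> and
      \<open>x\<close> cost one each in the exchange, and the added multiple of \<open>x\<close>
      costs \<open>s * \<epsilon>\<close>.\<close>
    moreover have "s * \<epsilon> \<le> \<epsilon>" using s1 \<epsilon> s(1) by (simp add: mult_left_le_one_le)
    ultimately show ?thesis by (simp add: algebra_simps)
  qed
  moreover have "nrm (E i) (v \<ominus>\<^bsub>E i\<^esub> q) \<le> nrm D (embed i v \<ominus>\<^bsub>D\<^esub> p)"
    "nrm (E i) (v \<oplus>\<^bsub>E i\<^esub> q) \<le> nrm D (embed i v \<oplus>\<^bsub>D\<^esub> p)" if v: "v \<in> carrier (E i)" for v
  proof -
    have ev: "embed i v \<in> carrier D" by (rule embed_in_D[OF i v])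
    have "v \<ominus>\<^bsub>E i\<^esub> q = (v \<ominus>\<^bsub>E i\<^esub> p i) \<oplus>\<^bsub>E i\<^esub> (- s) \<odot>\<^bsub>E i\<^esub> x"
      using v pi xc
      by (simp add: q_def Ei.minus_eq_smult Ei.smult_add_right Ei.smult_smult Ei.a_assoc)
    hence "nrm (E i) (v \<ominus>\<^bsub>E i\<^esub> q) \<le> nrm (E i) (v \<ominus>\<^bsub>E i\<^esub> p i) + s"
      using Ei.nrm_triangle[of "v \<ominus>\<^bsub>E i\<^esub> p i" "(- s) \<odot>\<^bsub>E i\<^esub> x"] v pi xc s(1)
      by (simp add: Ei.nrm_smult x1)
    also have "\<dots> \<le> N (a(i := nrm (E i) (v \<ominus>\<^bsub>E i\<^esub> p i)))"
      using s(2) Ei.nrm_nonneg v pi by simp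
    also have "\<dots> = nrm D (embed i v \<ominus>\<^bsub>D\<^esub> p)"
      unfolding nrm_D
    proof (rule N_cong[symmetric, OF norms_mem[OF minus_in_D[OF ev p(1)]]])
      fix j assume j: "j \<in> \<Lambda>"
      interpret Ej: real_normed_space "E j" by (rule normed[OF j])
      have pj: "p j \<in> carrier (E j)" by (rule coord_in_carrier[OF p(1) j])
      show "nrm (E j) ((embed i v \<ominus>\<^bsub>D\<^esub> p) j) = (a(i := nrm (E i) (v \<ominus>\<^bsub>E i\<^esub> p i))) j"
        using minus_D[OF ev p(1) j] j pj
        by (simp add: embed_def a_def Ej.minus_eq_smult Ej.nrm_smult)
    qed
    finally show "nrm (E i) (v \<ominus>\<^bsub>E i\<^esub> q) \<le> nrm D (embed i v \<ominus>\<^bsub>D\<^esub> p)" .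
    have "v \<oplus>\<^bsub>E i\<^esub> q = (v \<oplus>\<^bsub>E i\<^esub> p i) \<oplus>\<^bsub>E i\<^esub> s \<odot>\<^bsub>E i\<^esub> x"
      using v pi xc by (simp add: q_def Ei.a_assoc)
    hence "nrm (E i) (v \<oplus>\<^bsub>E i\<^esub> q) \<le> nrm (E i) (v \<oplus>\<^bsub>E i\<^esub> p i) + s"
      using Ei.nrm_triangle[of "v \<oplus>\<^bsub>E i\<^esub> p i" "s \<odot>\<^bsub>E i\<^esub> x"] v pi xc s(1)
      by (simp add: Ei.nrm_smult x1)
    also have "\<dots> \<le> N (a(i := nrm (E i) (v \<oplus>\<^bsub>E i\<^esub> p i)))"
      using s(2) Ei.nrm_nonneg v pi by simp
    also have "\<dots> = nrm D (embed i v \<oplus>\<^bsub>D\<^esub> p)"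
      unfolding nrm_D
    proof (rule N_cong[symmetric, OF norms_mem[OF add_in_D[OF ev p(1)]]])
      fix j assume j: "j \<in> \<Lambda>"
      interpret Ej: real_normed_space "E j" by (rule normed[OF j])
      have pj: "p j \<in> carrier (E j)" by (rule coord_in_carrier[OF p(1) j])
      show "nrm (E j) ((embed i v \<oplus>\<^bsub>D\<^esub> p) j) = (a(i := nrm (E i) (v \<oplus>\<^bsub>E i\<^esub> p i))) j"
        using j pj by (simp add: embed_def a_def add_D)
    qed
    finally show "nrm (E i) (v \<oplus>\<^bsub>E i\<^esub> q) \<le> nrm D (embed i v \<oplus>\<^bsub>D\<^esub> p)" .
  qed
  ultimately show ?thesis using q by blast
qed

text \<open>Projection to a coordinate triples the defect in the slice but does not increase
  distances, so the hypothesis on the sum is used at \<open>\<epsilon> / 3\<close>. Only the axioms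
  of \<open>sum_norm\<close> enter, which settles both sums at once.\<close>

lemma GL_space_component:
  assumes GL: "GL_space D" and i: "i \<in> \<Lambda>"
  shows "GL_space (E i)"
proof (rule real_normed_space.GL_spaceI[OF normed[OF i] banach[OF i]])
  fix x and \<epsilon> :: real
  assume x: "x \<in> unit_sphere (E i)" and \<epsilon>: "\<epsilon> > 0"
  have sphere: "embed i u \<in> unit_sphere D" if "u \<in> unit_sphere (E i)" for u
    using that i by (simp add: unit_sphere_def nrm_embed embed_in_D)
  obtain f where f: "contractive D f" and fx: "1 - \<epsilon> / 3 \<le> f (embed i x)"
    and near: "\<And>y. y \<in> unit_sphere D \<Longrightarrow> near_slices D f (\<epsilon> / 3) 1 y"
    using real_normed_space.GL_spaceD[OF normed_D GL sphere[OF x], of "\<epsilon> / 3"] \<epsilon> by auto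
  have proj: "\<exists>q \<in> carrier (E i). nrm (E i) q \<le> 1 \<and> 1 - \<epsilon> \<le> f (embed i q) \<and>
    (\<forall>v \<in> carrier (E i). nrm (E i) (v \<ominus>\<^bsub>E i\<^esub> q) \<le> nrm D (embed i v \<ominus>\<^bsub>D\<^esub> p) \<and>
       nrm (E i) (v \<oplus>\<^bsub>E i\<^esub> q) \<le> nrm D (embed i v \<oplus>\<^bsub>D\<^esub> p))"
    if "p \<in> carrier D" "nrm D p \<le> 1" "1 - \<epsilon> / 3 \<le> f p" for p
    using slice_point_of_component[OF f i _ x fx that] \<epsilon> by simp
  have "near_slices (E i) (\<lambda>u. f (embed i u)) \<epsilon> 1 y" if y: "y \<in> unit_sphere (E i)" for y
  proof -
    have yc: "y \<in> carrier (E i)" using y by (simp add: unit_sphere_def)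
    obtain z w where zw: "z \<in> carrier D" "w \<in> carrier D" "nrm D z \<le> 1" "nrm D w \<le> 1"
      "1 - \<epsilon> / 3 \<le> f z" "1 - \<epsilon> / 3 \<le> f w"
      "nrm D (embed i y \<ominus>\<^bsub>D\<^esub> z) + nrm D (embed i y \<oplus>\<^bsub>D\<^esub> w) \<le> 2 + \<epsilon> / 3"
      using near[OF sphere[OF y]] by (auto simp: near_slices_def)
    obtain z' where z': "z' \<in> carrier (E i)" "nrm (E i) z' \<le> 1" "1 - \<epsilon> \<le> f (embed i z')"
      "nrm (E i) (y \<ominus>\<^bsub>E i\<^esub> z') \<le> nrm D (embed i y \<ominus>\<^bsub>D\<^esub> z)"
      using proj[OF zw(1,3,5)] yc by blast
    obtain w' where w': "w' \<in> carrier (E i)" "nrm (E i) w' \<le> 1" "1 - \<epsilon> \<le> f (embed i w')"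
      "nrm (E i) (y \<oplus>\<^bsub>E i\<^esub> w') \<le> nrm D (embed i y \<oplus>\<^bsub>D\<^esub> w)"
      using proj[OF zw(2,4,6)] yc by blast
    show ?thesis
      unfolding near_slices_def using z' w' zw(7) \<epsilon>
      by (intro bexI[OF _ z'(1)] bexI[OF _ w'(1)]) auto
  qed
  thus "\<exists>g. contractive (E i) g \<and> 1 - \<epsilon> \<le> g x \<and> (\<forall>y \<in> unit_sphere (E i). near_slices (E i) g \<epsilon> 1 y)"
    using contractive_embed[OF f i] fx \<epsilon> by (intro exI[of _ "\<lambda>u. f (embed i u)"]) auto
qed

end

section \<open>The \<open>c\<^sub>0\<close>-sum and the \<open>l\<^sub>1\<close>-sum\<close>

definition c0_norm :: "'i set \<Rightarrow> ('i \<Rightarrow> real) \<Rightarrow> real" where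
  "c0_norm \<Lambda> a = Sup (insert 0 ((\<lambda>i. \<bar>a i\<bar>) ` \<Lambda>))"

definition l1_norm :: "'i set \<Rightarrow> ('i \<Rightarrow> real) \<Rightarrow> real" where
  "l1_norm \<Lambda> a = (\<Sum>\<^sub>\<infinity>i\<in>\<Lambda>. \<bar>a i\<bar>)"

section \<open>Families vanishing at infinity\<close>

lemma c0_families_finite: "a \<in> c0_families \<Lambda> \<Longrightarrow> \<delta> > 0 \<Longrightarrow> finite {i \<in> \<Lambda>. \<bar>a i\<bar> \<ge> \<delta>}"
  by (simp add: c0_families_def)

text \<open>The supremum is over a bounded set, since all but finitely many values lie below
  1.\<close>

lemma c0_norm_upper:
  assumes "a \<in> c0_families \<Lambda>"
  shows "0 \<le> c0_norm \<Lambda> a" "i \<in> \<Lambda> \<Longrightarrow> \<bar>a i\<bar> \<le> c0_norm \<Lambda> a"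
proof -
  let ?F = "{i \<in> \<Lambda>. \<bar>a i\<bar> \<ge> 1}"
  have "finite ?F" using assms by (simp add: c0_families_def)
  hence "bdd_above ((\<lambda>i. \<bar>a i\<bar>) ` ?F \<union> {..1})" by simp
  hence bdd: "bdd_above (insert 0 ((\<lambda>i. \<bar>a i\<bar>) ` \<Lambda>))"
    by (rule bdd_above_mono) auto
  show "0 \<le> c0_norm \<Lambda> a" unfolding c0_norm_def by (rule cSup_upper[OF _ bdd]) simp
  show "i \<in> \<Lambda> \<Longrightarrow> \<bar>a i\<bar> \<le> c0_norm \<Lambda> a"
    unfolding c0_norm_def by (rule cSup_upper[OF _ bdd]) simp
qed

lemma c0_norm_least: "0 \<le> d \<Longrightarrow> (\<And>i. i \<in> \<Lambda> \<Longrightarrow> \<bar>a i\<bar> \<le> d) \<Longrightarrow> c0_norm \<Lambda> a \<le> d"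
  unfolding c0_norm_def by (rule cSup_least) auto

lemma c0_families_solid:
  assumes "a \<in> c0_families \<Lambda>" "\<And>i. i \<in> \<Lambda> \<Longrightarrow> \<bar>b i\<bar> \<le> \<bar>a i\<bar>"
  shows "b \<in> c0_families \<Lambda>"
proof -
  have "finite {i \<in> \<Lambda>. \<bar>b i\<bar> \<ge> \<delta>}" if "\<delta> > 0" for \<delta>
  proof (rule finite_subset)
    show "{i \<in> \<Lambda>. \<bar>b i\<bar> \<ge> \<delta>} \<subseteq> {i \<in> \<Lambda>. \<bar>a i\<bar> \<ge> \<delta>}" using assms(2) by fastforce
  qed (use assms(1) that in \<open>simp add: c0_families_def\<close>)
  thus ?thesis by (simp add: c0_families_def)
qed

lemma c0_families_add:
  assumes "a \<in> c0_families \<Lambda>" "b \<in> c0_families \<Lambda>"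
  shows "(\<lambda>i. a i + b i) \<in> c0_families \<Lambda>"
proof -
  have "finite {i \<in> \<Lambda>. \<bar>a i + b i\<bar> \<ge> \<delta>}" if "\<delta> > 0" for \<delta>
  proof (rule finite_subset)
    show "{i \<in> \<Lambda>. \<bar>a i + b i\<bar> \<ge> \<delta>} \<subseteq> {i \<in> \<Lambda>. \<bar>a i\<bar> \<ge> \<delta> / 2} \<union> {i \<in> \<Lambda>. \<bar>b i\<bar> \<ge> \<delta> / 2}"
      by (auto; linarith)
  qed (intro finite_UnI c0_families_finite assms half_gt_zero that)
  thus ?thesis by (simp add: c0_families_def)
qed

lemma c0_families_scale:
  assumes "a \<in> c0_families \<Lambda>"
  shows "(\<lambda>i. c * a i) \<in> c0_families \<Lambda>"
proof -
  have "finite {i \<in> \<Lambda>. \<bar>c * a i\<bar> \<ge> \<delta>}" if "\<delta> > 0" for \<delta>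
  proof (cases "c = 0")
    case False
    hence "{i \<in> \<Lambda>. \<bar>c * a i\<bar> \<ge> \<delta>} = {i \<in> \<Lambda>. \<bar>a i\<bar> \<ge> \<delta> / \<bar>c\<bar>}"
      by (auto simp: abs_mult pos_divide_le_eq mult.commute)
    thus ?thesis using assms that False by (simp add: c0_families_def)
  qed (use that in simp)
  thus ?thesis by (simp add: c0_families_def)
qed

lemma c0_families_single: "(\<lambda>j. if j = i then c else 0) \<in> c0_families \<Lambda>"
proof -
  have "finite {j \<in> \<Lambda>. \<bar>if j = i then c else 0\<bar> \<ge> \<delta>}" if "\<delta> > 0" for \<delta>
    by (rule finite_subset[of _ "{i}"]) (use that in auto)
  thus ?thesis by (simp add: c0_families_def)
qed

lemma sum_norm_c0: "sum_norm \<Lambda> (c0_families \<Lambda>) (c0_norm \<Lambda>)"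
proof
  fix a b :: "'a \<Rightarrow> real" and c :: real and i
  assume a: "a \<in> c0_families \<Lambda>"
  note a_upper = c0_norm_upper[OF a]
  show "b \<in> c0_families \<Lambda>" if "\<And>i. i \<in> \<Lambda> \<Longrightarrow> \<bar>b i\<bar> \<le> \<bar>a i\<bar>"
    using c0_families_solid[OF a] that by blast
  show "c0_norm \<Lambda> b \<le> c0_norm \<Lambda> a" if "\<And>i. i \<in> \<Lambda> \<Longrightarrow> \<bar>b i\<bar> \<le> \<bar>a i\<bar>"
    using that a_upper by (intro c0_norm_least) (auto intro: order_trans)
  show "(\<lambda>i. c * a i) \<in> c0_families \<Lambda>" by (rule c0_families_scale[OF a])
  have scale_le: "c0_norm \<Lambda> (\<lambda>i. c * a i) \<le> \<bar>c\<bar> * c0_norm \<Lambda> a"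
    if "a \<in> c0_families \<Lambda>" for a c
    by (rule c0_norm_least)
      (auto simp: abs_mult intro!: mult_left_mono mult_nonneg_nonneg c0_norm_upper[OF that])
  show "c0_norm \<Lambda> (\<lambda>i. c * a i) = \<bar>c\<bar> * c0_norm \<Lambda> a"
  proof (rule antisym[OF scale_le[OF a]])
    \<comment> \<open>The reverse inequality is the one already known, applied to the scaled family
      and \<open>inverse c\<close>.\<close>
    show "\<bar>c\<bar> * c0_norm \<Lambda> a \<le> c0_norm \<Lambda> (\<lambda>i. c * a i)"
    proof (cases "c = 0")
      case True
      thus ?thesis using c0_norm_upper(1)[OF c0_families_scale[OF a, of c]] by simp
    next
      case False
      have "c0_norm \<Lambda> (\<lambda>i. inverse c * (c * a i)) \<le> \<bar>inverse c\<bar> * c0_norm \<Lambda> (\<lambda>i. c * a i)"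
        by (rule scale_le[OF c0_families_scale[OF a]])
      thus ?thesis using False by (simp add: field_simps)
    qed
  qed
  show "\<bar>a i\<bar> \<le> c0_norm \<Lambda> a" if "i \<in> \<Lambda>" using a_upper(2)[OF that] .
  show "(\<lambda>i. a i + b i) \<in> c0_families \<Lambda>" if "b \<in> c0_families \<Lambda>"
    by (rule c0_families_add[OF a that])
  show "c0_norm \<Lambda> (\<lambda>i. a i + b i) \<le> c0_norm \<Lambda> a + c0_norm \<Lambda> b" if "b \<in> c0_families \<Lambda>"
    using a_upper c0_norm_upper[OF that]
    by (intro c0_norm_least) (auto intro!: order_trans[OF abs_triangle_ineq] add_mono)
  \<comment> \<open>All coordinates are at most 1, so next to a coordinate equal to 1 the others do
    not raise the supremum: \<open>s = 0\<close>.\<close>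
  show "\<exists>s\<ge>0. (\<forall>b\<ge>0. b + s \<le> c0_norm \<Lambda> (a(i := b))) \<and> c0_norm \<Lambda> (a(i := 1)) \<le> 1 + s"
    if "c0_norm \<Lambda> a \<le> 1" "i \<in> \<Lambda>"
  proof (intro exI[of _ 0] conjI allI impI)
    fix b :: real assume "b \<ge> 0"
    have "(\<lambda>j. \<bar>a j\<bar>) \<in> c0_families \<Lambda>" by (rule c0_families_solid[OF a]) simp
    hence "(\<lambda>j. \<bar>a j\<bar> + (if j = i then \<bar>b\<bar> else 0)) \<in> c0_families \<Lambda>"
      by (intro c0_families_add c0_families_single)
    hence "a(i := b) \<in> c0_families \<Lambda>" by (rule c0_families_solid) auto
    from c0_norm_upper(2)[OF this \<open>i \<in> \<Lambda>\<close>] show "b + 0 \<le> c0_norm \<Lambda> (a(i := b))" by simp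
  next
    show "c0_norm \<Lambda> (a(i := 1)) \<le> 1 + 0"
      using that a_upper(2) by (intro c0_norm_least) (auto intro: order_trans)
  qed simp
next
  show "(\<lambda>_. 0) \<in> c0_families \<Lambda>" by (simp add: c0_families_def)
  fix i and c :: real assume i: "i \<in> \<Lambda>"
  show "(\<lambda>j. if j = i then c else 0) \<in> c0_families \<Lambda>" by (rule c0_families_single)
  show "c0_norm \<Lambda> (\<lambda>j. if j = i then c else 0) = \<bar>c\<bar>"
    using c0_norm_upper(2)[OF c0_families_single i, of i c]
    by (intro antisym c0_norm_least) auto
next
  fix s :: "nat \<Rightarrow> 'a \<Rightarrow> real" and b :: "'a \<Rightarrow> real" and d :: real
  assume s: "\<And>n. s n \<in> c0_families \<Lambda>"
    and lim: "\<And>i. i \<in> \<Lambda> \<Longrightarrow> (\<lambda>n. s n i) \<longlonglongrightarrow> b i"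
  show "c0_norm \<Lambda> b \<le> d" if d: "\<And>n. c0_norm \<Lambda> (s n) \<le> d"
  proof (rule c0_norm_least)
    show "0 \<le> d" using c0_norm_upper(1)[OF s, of 0] d[of 0] by simp
    fix i assume i: "i \<in> \<Lambda>"
    have "\<bar>s n i\<bar> \<le> d" for n using c0_norm_upper(2)[OF s i, of n] d[of n] by simp
    thus "\<bar>b i\<bar> \<le> d"
      using LIMSEQ_le_const2[OF tendsto_rabs[OF lim[OF i]]] by blast
  qed
  assume Cauchy: "\<And>\<epsilon>. \<epsilon> > 0 \<Longrightarrow> \<exists>M. \<forall>n\<ge>M. \<forall>m\<ge>M. c0_norm \<Lambda> (\<lambda>i. s n i - s m i) < \<epsilon>"
  have "finite {i \<in> \<Lambda>. \<bar>b i\<bar> \<ge> \<delta>}" if \<delta>: "\<delta> > 0" for \<delta>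
  proof -
    \<comment> \<open>The single term \<open>s M\<close> controls the limit: \<open>b\<close> stays
      within \<open>\<delta> / 2\<close> of it on \<open>\<Lambda>\<close>, so wherever
      \<open>b\<close> reaches \<open>\<delta>\<close>, \<open>s M\<close> reaches
      \<open>\<delta> / 2\<close>, which happens only finitely often.\<close>
    obtain M where M: "\<And>m. m \<ge> M \<Longrightarrow> c0_norm \<Lambda> (\<lambda>i. s M i - s m i) < \<delta> / 2"
      using Cauchy[of "\<delta> / 2"] \<delta> by auto
    have mem: "(\<lambda>i. s M i - s m i) \<in> c0_families \<Lambda>" for m
      using c0_families_add[OF s[of M] c0_families_scale[OF s[of m], of "-1"]] by simp
    have "\<bar>s M i - b i\<bar> \<le> \<delta> / 2" if i: "i \<in> \<Lambda>" for i
    proof (rule LIMSEQ_le_const2)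
      show "(\<lambda>m. \<bar>s M i - s m i\<bar>) \<longlonglongrightarrow> \<bar>s M i - b i\<bar>" by (intro tendsto_intros lim i)
      have "\<bar>s M i - s m i\<bar> \<le> \<delta> / 2" if "m \<ge> M" for m
        using c0_norm_upper(2)[OF mem i, of m] M[OF that] by simp
      thus "\<exists>N. \<forall>n\<ge>N. \<bar>s M i - s n i\<bar> \<le> \<delta> / 2" by blast
    qed
    hence "\<bar>s M i\<bar> \<ge> \<delta> / 2" if "i \<in> \<Lambda>" "\<bar>b i\<bar> \<ge> \<delta>" for i
      using that by (smt (verit) field_sum_of_halves)
    hence "{i \<in> \<Lambda>. \<bar>b i\<bar> \<ge> \<delta>} \<subseteq> {i \<in> \<Lambda>. \<bar>s M i\<bar> \<ge> \<delta> / 2}" by blast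
    moreover have "finite {i \<in> \<Lambda>. \<bar>s M i\<bar> \<ge> \<delta> / 2}"
      using s[of M] \<delta> by (intro c0_families_finite half_gt_zero)
    ultimately show ?thesis by (rule finite_subset)
  qed
  thus "b \<in> c0_families \<Lambda>" by (simp add: c0_families_def)
qed

text \<open>Only finitely many values reach half the norm, so the supremum is in effect a finite
  maximum.\<close>

lemma c0_norm_attained:
  assumes a: "a \<in> c0_families \<Lambda>" and pos: "c0_norm \<Lambda> a > 0"
  shows "\<exists>i\<in>\<Lambda>. \<bar>a i\<bar> = c0_norm \<Lambda> a"
proof (rule ccontr)
  assume "\<not> ?thesis"
  hence less: "\<bar>a i\<bar> < c0_norm \<Lambda> a" if "i \<in> \<Lambda>" for i
    using c0_norm_upper(2)[OF a that] that by fastforce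
  let ?F = "{i \<in> \<Lambda>. \<bar>a i\<bar> \<ge> c0_norm \<Lambda> a / 2}"
  \<comment> \<open>The inserted value keeps the maximum defined for empty \<open>?F\<close> and
    bounds the coordinates outside \<open>?F\<close>.\<close>
  define m where "m = Max (insert (c0_norm \<Lambda> a / 2) ((\<lambda>i. \<bar>a i\<bar>) ` ?F))"
  have fin: "finite ?F" using a pos by (intro c0_families_finite half_gt_zero)
  have half: "c0_norm \<Lambda> a / 2 \<le> m" unfolding m_def using fin by (intro Max_ge) auto
  have "m < c0_norm \<Lambda> a" unfolding m_def using fin pos less by (subst Max_less_iff) auto
  moreover have "c0_norm \<Lambda> a \<le> m"
  proof (rule c0_norm_least)
    show "0 \<le> m" using half pos by simp
    fix i assume i: "i \<in> \<Lambda>"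
    show "\<bar>a i\<bar> \<le> m"
    proof (cases "i \<in> ?F")
      case True
      thus ?thesis unfolding m_def using fin by (intro Max_ge) auto
    next
      case False
      thus ?thesis using half i by simp
    qed
  qed
  ultimately show False by simp
qed

section \<open>Absolutely summable families\<close>

lemma l1_norm_coord:
  assumes a: "a \<in> l1_families \<Lambda>" and F: "finite F" "F \<subseteq> \<Lambda>"
  shows "(\<Sum>i\<in>F. \<bar>a i\<bar>) \<le> l1_norm \<Lambda> a"
  using a F unfolding l1_norm_def l1_families_def by (intro finite_sum_le_infsum) auto

lemma l1_families_I:
  assumes "g summable_on \<Lambda>" "\<And>i. i \<in> \<Lambda> \<Longrightarrow> \<bar>b i\<bar> \<le> g i"
  shows "b \<in> l1_families \<Lambda>" "l1_norm \<Lambda> b \<le> infsum g \<Lambda>"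
proof -
  have b: "(\<lambda>i. \<bar>b i\<bar>) summable_on \<Lambda>"
    by (rule summable_on_comparison_test[OF assms]) auto
  thus "b \<in> l1_families \<Lambda>" by (simp add: l1_families_def)
  show "l1_norm \<Lambda> b \<le> infsum g \<Lambda>" unfolding l1_norm_def by (rule infsum_mono[OF b assms])
qed

text \<open>Finite partial sums pass to the limit, and a common bound for them yields both
  summability and the bound for the whole sum.\<close>

lemma l1_norm_fatou:
  assumes s: "\<And>n::nat. s n \<in> l1_families \<Lambda>" and d: "\<And>n. l1_norm \<Lambda> (s n) \<le> d"
    and lim: "\<And>i. i \<in> \<Lambda> \<Longrightarrow> (\<lambda>n. s n i) \<longlonglongrightarrow> b i"
  shows "b \<in> l1_families \<Lambda>" "l1_norm \<Lambda> b \<le> d"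
proof -
  have le: "(\<Sum>i\<in>F. \<bar>b i\<bar>) \<le> d" if F: "finite F" "F \<subseteq> \<Lambda>" for F
  proof (rule LIMSEQ_le_const2)
    show "(\<lambda>n. \<Sum>i\<in>F. \<bar>s n i\<bar>) \<longlonglongrightarrow> (\<Sum>i\<in>F. \<bar>b i\<bar>)"
      using F by (intro tendsto_intros lim) auto
    show "\<exists>N. \<forall>n\<ge>N. (\<Sum>i\<in>F. \<bar>s n i\<bar>) \<le> d"
      using l1_norm_coord[OF s F] d order_trans by blast
  qed
  have b: "(\<lambda>i. \<bar>b i\<bar>) summable_on \<Lambda>"
    by (rule nonneg_bdd_above_summable_on) (auto intro!: bdd_aboveI2[of _ _ d] le)
  thus "b \<in> l1_families \<Lambda>" by (simp add: l1_families_def)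
  show "l1_norm \<Lambda> b \<le> d" unfolding l1_norm_def by (rule infsum_le_finite_sums[OF b le])
qed

lemma l1_single:
  "(\<lambda>j. if j = i then c else 0) \<in> l1_families \<Lambda>"
  "i \<in> \<Lambda> \<Longrightarrow> l1_norm \<Lambda> (\<lambda>j. if j = i then c else 0) = \<bar>c\<bar>"
proof -
  show "(\<lambda>j. if j = i then c else 0) \<in> l1_families \<Lambda>"
    unfolding l1_families_def
    by (auto intro!: finite_nonzero_values_imp_summable_on finite_subset[of _ "{i}"] split: if_splits)
  assume "i \<in> \<Lambda>"
  hence "l1_norm \<Lambda> (\<lambda>j. if j = i then c else 0) = infsum (\<lambda>_. \<bar>c\<bar>) {i}"
    unfolding l1_norm_def by (intro infsum_cong_neutral) auto
  thus "l1_norm \<Lambda> (\<lambda>j. if j = i then c else 0) = \<bar>c\<bar>" by simp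
qed

text \<open>Isolates the sum over the other coordinates, which is the number \<open>s\<close> of
  \<open>split_coord\<close>.\<close>

lemma l1_norm_upd:
  assumes a: "a \<in> l1_families \<Lambda>" and i: "i \<in> \<Lambda>"
  shows "l1_norm \<Lambda> (a(i := b)) = \<bar>b\<bar> + (\<Sum>\<^sub>\<infinity>j\<in>\<Lambda> - {i}. \<bar>a j\<bar>)"
proof -
  have "(\<lambda>j. \<bar>a j\<bar>) summable_on (\<Lambda> - {i})"
    using a unfolding l1_families_def by (auto intro: summable_on_subset_banach)
  hence "(\<lambda>j. \<bar>(a(i := b)) j\<bar>) summable_on (\<Lambda> - {i})"
    by (subst summable_on_cong[where g = "\<lambda>j. \<bar>a j\<bar>"]) auto
  hence "(\<Sum>\<^sub>\<infinity>j\<in>insert i (\<Lambda> - {i}). \<bar>(a(i := b)) j\<bar>)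
      = \<bar>(a(i := b)) i\<bar> + (\<Sum>\<^sub>\<infinity>j\<in>\<Lambda> - {i}. \<bar>(a(i := b)) j\<bar>)"
    by (rule infsum_insert) simp
  moreover have "(\<Sum>\<^sub>\<infinity>j\<in>\<Lambda> - {i}. \<bar>(a(i := b)) j\<bar>) = (\<Sum>\<^sub>\<infinity>j\<in>\<Lambda> - {i}. \<bar>a j\<bar>)"
    by (rule infsum_cong) simp
  ultimately show ?thesis using i by (simp add: l1_norm_def insert_absorb)
qed

lemma sum_norm_l1: "sum_norm \<Lambda> (l1_families \<Lambda>) (l1_norm \<Lambda>)"
proof
  fix a b :: "'a \<Rightarrow> real" and c :: real and i
  assume a: "a \<in> l1_families \<Lambda>"
  hence a_sum: "(\<lambda>i. \<bar>a i\<bar>) summable_on \<Lambda>" by (simp add: l1_families_def)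
  show "b \<in> l1_families \<Lambda>" if "\<And>i. i \<in> \<Lambda> \<Longrightarrow> \<bar>b i\<bar> \<le> \<bar>a i\<bar>"
    by (rule l1_families_I(1)[OF a_sum that])
  show "l1_norm \<Lambda> b \<le> l1_norm \<Lambda> a" if "\<And>i. i \<in> \<Lambda> \<Longrightarrow> \<bar>b i\<bar> \<le> \<bar>a i\<bar>"
    using l1_families_I(2)[OF a_sum that] by (simp add: l1_norm_def)
  show "(\<lambda>i. c * a i) \<in> l1_families \<Lambda>"
    using summable_on_cmult_right[OF a_sum, of "\<bar>c\<bar>"] by (simp add: l1_families_def abs_mult)
  show "l1_norm \<Lambda> (\<lambda>i. c * a i) = \<bar>c\<bar> * l1_norm \<Lambda> a"
    by (simp add: l1_norm_def abs_mult infsum_cmult_right')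
  show "\<bar>a i\<bar> \<le> l1_norm \<Lambda> a" if "i \<in> \<Lambda>" using l1_norm_coord[OF a, of "{i}"] that by simp
  show "(\<lambda>i. a i + b i) \<in> l1_families \<Lambda>"
    "l1_norm \<Lambda> (\<lambda>i. a i + b i) \<le> l1_norm \<Lambda> a + l1_norm \<Lambda> b" if b: "b \<in> l1_families \<Lambda>"
  proof -
    have b_sum: "(\<lambda>i. \<bar>b i\<bar>) summable_on \<Lambda>" using b by (simp add: l1_families_def)
    note ab = l1_families_I[OF summable_on_add[OF a_sum b_sum] abs_triangle_ineq]
    show "(\<lambda>i. a i + b i) \<in> l1_families \<Lambda>" by (rule ab(1))
    show "l1_norm \<Lambda> (\<lambda>i. a i + b i) \<le> l1_norm \<Lambda> a + l1_norm \<Lambda> b"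
      using ab(2) by (simp add: infsum_add[OF a_sum b_sum] l1_norm_def)
  qed
  show "\<exists>s\<ge>0. (\<forall>b\<ge>0. b + s \<le> l1_norm \<Lambda> (a(i := b))) \<and> l1_norm \<Lambda> (a(i := 1)) \<le> 1 + s"
    if "i \<in> \<Lambda>"
    by (intro exI[of _ "\<Sum>\<^sub>\<infinity>j\<in>\<Lambda> - {i}. \<bar>a j\<bar>"]) (auto simp: l1_norm_upd[OF a that] intro: infsum_nonneg)
next
  show "(\<lambda>_. 0) \<in> l1_families \<Lambda>" by (simp add: l1_families_def)
  fix i and c :: real assume i: "i \<in> \<Lambda>"
  show "(\<lambda>j. if j = i then c else 0) \<in> l1_families \<Lambda>" by (rule l1_single(1))
  show "l1_norm \<Lambda> (\<lambda>j. if j = i then c else 0) = \<bar>c\<bar>" by (rule l1_single(2)[OF i])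
next
  fix s :: "nat \<Rightarrow> 'a \<Rightarrow> real" and b :: "'a \<Rightarrow> real" and d :: real
  assume s: "\<And>n. s n \<in> l1_families \<Lambda>"
    and lim: "\<And>i. i \<in> \<Lambda> \<Longrightarrow> (\<lambda>n. s n i) \<longlonglongrightarrow> b i"
  show "l1_norm \<Lambda> b \<le> d" if "\<And>n. l1_norm \<Lambda> (s n) \<le> d"
    by (rule l1_norm_fatou(2)[OF s that lim])
  assume "\<And>\<epsilon>. \<epsilon> > 0 \<Longrightarrow> \<exists>M. \<forall>n\<ge>M. \<forall>m\<ge>M. l1_norm \<Lambda> (\<lambda>i. s n i - s m i) < \<epsilon>"
  \<comment> \<open>Of the Cauchy property only boundedness of the norms from \<open>M\<close> on is
    kept; \<open>l1_norm_fatou\<close> turns it into summability of the limit.\<close>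
  from this[of 1] obtain M where
    M: "\<And>n. n \<ge> M \<Longrightarrow> l1_norm \<Lambda> (\<lambda>i. s n i - s M i) < 1" by auto
  show "b \<in> l1_families \<Lambda>"
  proof (rule l1_norm_fatou(1)[where s = "\<lambda>n. s (n + M)"])
    show "s (n + M) \<in> l1_families \<Lambda>" for n by (rule s)
    show "(\<lambda>n. s (n + M) i) \<longlonglongrightarrow> b i" if "i \<in> \<Lambda>" for i
      using LIMSEQ_ignore_initial_segment[OF lim[OF that]] .
    show "l1_norm \<Lambda> (s (n + M)) \<le> 1 + l1_norm \<Lambda> (s M)" for n
    proof -
      have sums: "(\<lambda>i. \<bar>s k i\<bar>) summable_on \<Lambda>" for k using s by (simp add: l1_families_def)
      have diff: "(\<lambda>i. \<bar>s (n + M) i - s M i\<bar>) summable_on \<Lambda>"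
        using l1_families_I(1)[OF summable_on_add[OF sums[of "n + M"] sums[of M]] abs_triangle_ineq4]
        by (simp add: l1_families_def)
      have "l1_norm \<Lambda> (s (n + M)) \<le> (\<Sum>\<^sub>\<infinity>i\<in>\<Lambda>. \<bar>s (n + M) i - s M i\<bar> + \<bar>s M i\<bar>)"
        by (rule l1_families_I(2)[OF summable_on_add[OF diff sums]]) linarith
      also have "\<dots> = l1_norm \<Lambda> (\<lambda>i. s (n + M) i - s M i) + l1_norm \<Lambda> (s M)"
        unfolding l1_norm_def by (rule infsum_add[OF diff sums])
      finally show ?thesis using M[of "n + M"] by simp
    qed
  qed
qed

text \<open>The functional sees one coordinate only, and changing that coordinate within the unit
  ball never leaves the ball of the sum. So \<open>y\<close> and its negative, each with coordinate
  \<open>i\<close> replaced, are approximating points whose distances are those in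
  \<open>E i\<close>.\<close>

lemma GL_space_c0_sum:
  fixes E :: "'i \<Rightarrow> 'a normed_space"
  assumes banach: "\<And>i. i \<in> \<Lambda> \<Longrightarrow> banach_space (E i)"
    and GL: "\<And>i. i \<in> \<Lambda> \<Longrightarrow> GL_space (E i)"
  shows "GL_space (direct_sum \<Lambda> E (c0_families \<Lambda>) (c0_norm \<Lambda>))"
proof -
  interpret banach_sum \<Lambda> "c0_families \<Lambda>" "c0_norm \<Lambda>" E
    using sum_norm_c0 banach by (simp add: banach_sum_def banach_sum_axioms_def)
  interpret D: real_normed_space D by (rule normed_D)
  show ?thesis
  proof (rule D.GL_spaceI[OF banach_D])
    fix x and \<epsilon> :: real assume x: "x \<in> unit_sphere D" and \<epsilon>: "\<epsilon> > 0"
    have xc: "x \<in> carrier D" and x1: "c0_norm \<Lambda> (\<lambda>i. nrm (E i) (x i)) = 1"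
      using x by (simp_all add: unit_sphere_def nrm_D)
    obtain i where i: "i \<in> \<Lambda>" and "\<bar>nrm (E i) (x i)\<bar> = 1"
      using c0_norm_attained[OF norms_mem[OF xc]] x1 by auto
    interpret Ei: real_normed_space "E i" by (rule normed[OF i])
    have xi: "x i \<in> unit_sphere (E i)"
      using \<open>\<bar>nrm (E i) (x i)\<bar> = 1\<close> coord_in_carrier[OF xc i] Ei.nrm_nonneg
      by (simp add: unit_sphere_def)
    obtain f where f: "contractive (E i) f" and fx: "1 - \<epsilon> \<le> f (x i)"
      and near: "\<And>y. y \<in> unit_sphere (E i) \<Longrightarrow> near_slices (E i) f \<epsilon> 1 y"
      using Ei.GL_spaceD[OF GL[OF i] xi \<epsilon>] by blast
    have "contractive D (\<lambda>z. f (z i))"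
      unfolding contractive_def
    proof (intro conjI ballI allI)
      fix z assume z: "z \<in> carrier D"
      have zi: "z i \<in> carrier (E i)" by (rule coord_in_carrier[OF z i])
      show "f ((a \<odot>\<^bsub>D\<^esub> z) i) = a * f (z i)" for a
        using f zi i by (simp add: contractive_def smult_D)
      show "\<bar>f (z i)\<bar> \<le> nrm D z"
        using f zi nrm_coord_le[OF z i] unfolding contractive_def by fastforce
      fix w assume "w \<in> carrier D"
      thus "f ((z \<oplus>\<^bsub>D\<^esub> w) i) = f (z i) + f (w i)"
        using f zi coord_in_carrier[OF _ i] i by (simp add: contractive_def add_D)
    qed
    moreover have "near_slices D (\<lambda>z. f (z i)) \<epsilon> 1 y" if y: "y \<in> unit_sphere D" for y
    proof -
      have yc: "y \<in> carrier D" and y1: "nrm D y = 1" using y by (simp_all add: unit_sphere_def)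
      have yi: "y i \<in> carrier (E i)" by (rule coord_in_carrier[OF yc i])
      \<comment> \<open>\<open>y i\<close> is only known to lie in the ball, hence the convexity
        argument; the sphere of \<open>E i\<close> is nonempty because it contains
        \<open>x i\<close>.\<close>
      have "near_slices (E i) f \<epsilon> 1 (y i)"
        using Ei.near_slices_ball[OF f near _ yi] xi nrm_coord_le[OF yc i] y1 by auto
      then obtain z w where zw: "z \<in> carrier (E i)" "w \<in> carrier (E i)" "nrm (E i) z \<le> 1"
        "nrm (E i) w \<le> 1" "1 - \<epsilon> \<le> f z" "1 - \<epsilon> \<le> f w"
        "nrm (E i) (y i \<ominus>\<^bsub>E i\<^esub> z) + nrm (E i) (y i \<oplus>\<^bsub>E i\<^esub> w) \<le> 2 + \<epsilon>"
        by (auto simp: near_slices_def)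
      have ball: "nrm D (v(i := u)) \<le> 1"
        if "v \<in> carrier D" "nrm D v \<le> 1" "u \<in> carrier (E i)" "nrm (E i) u \<le> 1" for u v
        unfolding nrm_upd[OF that(1) i that(3)]
      proof (rule c0_norm_least)
        fix j assume j: "j \<in> \<Lambda>"
        show "\<bar>((\<lambda>j. nrm (E j) (v j))(i := nrm (E i) u)) j\<bar> \<le> 1"
          using that nrm_coord_le[OF that(1) j] Ei.nrm_nonneg
            real_normed_space.nrm_nonneg[OF normed[OF j] coord_in_carrier[OF that(1) j]] by simp
      qed simp
      have single: "nrm D v \<le> nrm (E i) (v i)"
        if v: "v \<in> carrier D" and 0: "\<And>j. j \<in> \<Lambda> \<Longrightarrow> j \<noteq> i \<Longrightarrow> nrm (E j) (v j) = 0" for v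
      proof -
        have "nrm D v \<le> c0_norm \<Lambda> (\<lambda>j. if j = i then nrm (E i) (v i) else 0)"
          by (rule nrm_D_le[OF _ single_mem[OF i]]) (auto simp: 0 coord_in_carrier[OF v])
        thus ?thesis using N_single[OF i] Ei.nrm_nonneg coord_in_carrier[OF v i] by simp
      qed
      \<comment> \<open>The second point is added to \<open>y\<close>, so off \<open>i\<close> it
        has to be the negative of \<open>y\<close> for the coordinates to cancel.\<close>
      define y' where "y' = (-1) \<odot>\<^bsub>D\<^esub> y"
      have y': "y' \<in> carrier D" "nrm D y' \<le> 1"
        using yc y1 by (simp_all add: y'_def D.nrm_smult)
      have zD: "y(i := z) \<in> carrier D" and wD: "y'(i := w) \<in> carrier D"
        using upd_in_D i zw yc y' by auto
      have "nrm D (y \<ominus>\<^bsub>D\<^esub> y(i := z)) \<le> nrm (E i) (y i \<ominus>\<^bsub>E i\<^esub> z)"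
      proof (rule order_trans[OF single])
        show "y \<ominus>\<^bsub>D\<^esub> y(i := z) \<in> carrier D" by (rule minus_in_D[OF yc zD])
        show "nrm (E j) ((y \<ominus>\<^bsub>D\<^esub> y(i := z)) j) = 0" if "j \<in> \<Lambda>" "j \<noteq> i" for j
          using that minus_D[OF yc zD that(1)] coord_in_carrier[OF yc that(1)]
            real_normed_space.nrm_minus_self[OF normed] by simp
      qed (simp add: minus_D[OF yc zD i])
      moreover have "nrm D (y \<oplus>\<^bsub>D\<^esub> y'(i := w)) \<le> nrm (E i) (y i \<oplus>\<^bsub>E i\<^esub> w)"
      proof (rule order_trans[OF single])
        show "y \<oplus>\<^bsub>D\<^esub> y'(i := w) \<in> carrier D" by (rule add_in_D[OF yc wD])
        show "nrm (E j) ((y \<oplus>\<^bsub>D\<^esub> y'(i := w)) j) = 0" if j: "j \<in> \<Lambda>" "j \<noteq> i" for j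
        proof -
          interpret Ej: real_normed_space "E j" by (rule normed[OF j(1)])
          show ?thesis
            using j coord_in_carrier[OF yc j(1)] Ej.nrm_minus_self[of "y j"]
            by (simp add: y'_def add_D smult_D Ej.minus_eq_smult)
        qed
      qed (simp add: add_D i)
      ultimately show ?thesis
        unfolding near_slices_def using zw y1 ball[OF yc _ zw(1,3)] ball[OF y' zw(2,4)]
        by (intro bexI[OF _ zD] bexI[OF _ wD]) auto
    qed
    ultimately show "\<exists>f. contractive D f \<and> 1 - \<epsilon> \<le> f x \<and> (\<forall>y \<in> unit_sphere D. near_slices D f \<epsilon> 1 y)"
      using fx by blast
  qed
qed

text \<open>Every condition in \<open>near_slices\<close> at radius \<open>nrm (E i) (y i)\<close>
  is linear in the radius, and the radii add up to the norm of \<open>y\<close>, which is 1; summing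
  over all coordinates therefore gives the conditions at radius 1.\<close>

lemma GL_space_l1_sum:
  fixes E :: "'i \<Rightarrow> 'a normed_space"
  assumes banach: "\<And>i. i \<in> \<Lambda> \<Longrightarrow> banach_space (E i)"
    and GL: "\<And>i. i \<in> \<Lambda> \<Longrightarrow> GL_space (E i)"
  shows "GL_space (direct_sum \<Lambda> E (l1_families \<Lambda>) (l1_norm \<Lambda>))"
proof -
  interpret banach_sum \<Lambda> "l1_families \<Lambda>" "l1_norm \<Lambda>" E
    using sum_norm_l1 banach by (simp add: banach_sum_def banach_sum_axioms_def)
  interpret D: real_normed_space D by (rule normed_D)
  have abs_nrm: "\<bar>nrm (E i) (z i)\<bar> = nrm (E i) (z i)" if "z \<in> carrier D" "i \<in> \<Lambda>" for z i
    using real_normed_space.nrm_nonneg[OF normed coord_in_carrier] that by simp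
  have nrm_sum: "nrm D z = (\<Sum>\<^sub>\<infinity>i\<in>\<Lambda>. nrm (E i) (z i))"
    and nrm_summable: "(\<lambda>i. nrm (E i) (z i)) summable_on \<Lambda>" if z: "z \<in> carrier D" for z
  proof -
    show "nrm D z = (\<Sum>\<^sub>\<infinity>i\<in>\<Lambda>. nrm (E i) (z i))"
      unfolding nrm_D l1_norm_def by (rule infsum_cong) (rule abs_nrm[OF z])
    show "(\<lambda>i. nrm (E i) (z i)) summable_on \<Lambda>"
      using norms_mem[OF z] abs_nrm[OF z] by (simp add: l1_families_def cong: summable_on_cong)
  qed
  show ?thesis
  proof (rule D.GL_spaceI[OF banach_D])
    fix x and \<epsilon> :: real assume x: "x \<in> unit_sphere D" and \<epsilon>: "\<epsilon> > 0"
    have xc: "x \<in> carrier D" and x1: "nrm D x = 1" using x by (simp_all add: unit_sphere_def)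
    have "\<forall>i\<in>\<Lambda>. \<exists>f. contractive (E i) f \<and> (1 - \<epsilon>) * nrm (E i) (x i) \<le> f (x i) \<and>
        (\<forall>y \<in> carrier (E i). near_slices (E i) f \<epsilon> (nrm (E i) y) y)"
      using real_normed_space.GL_spaceD_carrier[OF normed GL coord_in_carrier[OF xc] \<epsilon>] by blast
    from bchoice[OF this] obtain f where
      f: "\<And>i. i \<in> \<Lambda> \<Longrightarrow> contractive (E i) (f i)"
      and fx: "\<And>i. i \<in> \<Lambda> \<Longrightarrow> (1 - \<epsilon>) * nrm (E i) (x i) \<le> f i (x i)"
      and near: "\<And>i y. i \<in> \<Lambda> \<Longrightarrow> y \<in> carrier (E i) \<Longrightarrow> near_slices (E i) (f i) \<epsilon> (nrm (E i) y) y"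
      by blast
    \<comment> \<open>The series converges absolutely at points of \<open>D\<close>, being dominated
      by the series of norms.\<close>
    define F where "F z = (\<Sum>\<^sub>\<infinity>i\<in>\<Lambda>. f i (z i))" for z
    have f_le: "norm (f i (z i)) \<le> nrm (E i) (z i)" if "z \<in> carrier D" "i \<in> \<Lambda>" for z i
      using f[OF that(2)] coord_in_carrier[OF that] by (simp add: contractive_def)
    have f_abs_summable: "(\<lambda>i. norm (f i (z i))) summable_on \<Lambda>" if "z \<in> carrier D" for z
      by (rule Infinite_Sum.abs_summable_on_comparison_test'[OF nrm_summable[OF that] f_le[OF that]])
    have f_summable: "(\<lambda>i. f i (z i)) summable_on \<Lambda>" if "z \<in> carrier D" for z
      by (rule abs_summable_summable[OF f_abs_summable[OF that]])
    have "contractive D F"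
      unfolding contractive_def
    proof (intro conjI ballI allI)
      fix z assume z: "z \<in> carrier D"
      show "F (a \<odot>\<^bsub>D\<^esub> z) = a * F z" for a
      proof -
        have "f i ((a \<odot>\<^bsub>D\<^esub> z) i) = a * f i (z i)" if "i \<in> \<Lambda>" for i
          using f[OF that] coord_in_carrier[OF z that] that by (simp add: contractive_def smult_D)
        thus ?thesis unfolding F_def by (simp add: infsum_cmult_right' cong: infsum_cong)
      qed
      have "\<bar>F z\<bar> \<le> (\<Sum>\<^sub>\<infinity>i\<in>\<Lambda>. norm (f i (z i)))"
        unfolding F_def using norm_infsum_bound[OF f_abs_summable[OF z]] by simp
      also have "\<dots> \<le> nrm D z"
        unfolding nrm_sum[OF z]
        by (rule infsum_mono[OF f_abs_summable[OF z] nrm_summable[OF z] f_le[OF z]])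
      finally show "\<bar>F z\<bar> \<le> nrm D z" .
      fix w assume w: "w \<in> carrier D"
      have "f i ((z \<oplus>\<^bsub>D\<^esub> w) i) = f i (z i) + f i (w i)" if "i \<in> \<Lambda>" for i
        using f[OF that] coord_in_carrier[OF z that] coord_in_carrier[OF w that] that
        by (simp add: contractive_def add_D)
      thus "F (z \<oplus>\<^bsub>D\<^esub> w) = F z + F w"
        unfolding F_def using infsum_add[OF f_summable[OF z] f_summable[OF w]]
        by (simp cong: infsum_cong)
    qed
    \<comment> \<open>Used with \<open>y = z = x\<close> for the value at \<open>x\<close>, and with
      the given unit vector \<open>y\<close> for the two approximating points.\<close>
    moreover have F_ge: "1 - \<epsilon> \<le> F z"
      if z: "z \<in> carrier D" and y: "y \<in> carrier D" "nrm D y = 1"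
        and le: "\<And>i. i \<in> \<Lambda> \<Longrightarrow> (1 - \<epsilon>) * nrm (E i) (y i) \<le> f i (z i)" for y z
    proof -
      have "1 - \<epsilon> = (\<Sum>\<^sub>\<infinity>i\<in>\<Lambda>. (1 - \<epsilon>) * nrm (E i) (y i))"
        using nrm_sum[OF y(1)] y(2) by (simp add: infsum_cmult_right')
      also have "\<dots> \<le> F z" unfolding F_def
        by (rule infsum_mono[OF summable_on_cmult_right[OF nrm_summable[OF y(1)]] f_summable[OF z] le])
      finally show ?thesis .
    qed
    moreover have "near_slices D F \<epsilon> 1 y" if y: "y \<in> unit_sphere D" for y
    proof -
      have yc: "y \<in> carrier D" and y1: "nrm D y = 1" using y by (simp_all add: unit_sphere_def)
      \<comment> \<open>Pairs, because both points must come from the same choice: the inequality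
        for the distances couples them.\<close>
      have "\<forall>i\<in>\<Lambda>. \<exists>p. fst p \<in> carrier (E i) \<and> snd p \<in> carrier (E i) \<and>
          nrm (E i) (fst p) \<le> nrm (E i) (y i) \<and> nrm (E i) (snd p) \<le> nrm (E i) (y i) \<and>
          (1 - \<epsilon>) * nrm (E i) (y i) \<le> f i (fst p) \<and> (1 - \<epsilon>) * nrm (E i) (y i) \<le> f i (snd p) \<and>
          nrm (E i) (y i \<ominus>\<^bsub>E i\<^esub> fst p) + nrm (E i) (y i \<oplus>\<^bsub>E i\<^esub> snd p) \<le> (2 + \<epsilon>) * nrm (E i) (y i)"
        using near coord_in_carrier[OF yc] unfolding near_slices_def by fastforce
      from bchoice[OF this] obtain p where p: "\<And>i. i \<in> \<Lambda> \<Longrightarrow>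
          fst (p i) \<in> carrier (E i) \<and> snd (p i) \<in> carrier (E i) \<and>
          nrm (E i) (fst (p i)) \<le> nrm (E i) (y i) \<and> nrm (E i) (snd (p i)) \<le> nrm (E i) (y i) \<and>
          (1 - \<epsilon>) * nrm (E i) (y i) \<le> f i (fst (p i)) \<and>
          (1 - \<epsilon>) * nrm (E i) (y i) \<le> f i (snd (p i)) \<and>
          nrm (E i) (y i \<ominus>\<^bsub>E i\<^esub> fst (p i)) + nrm (E i) (y i \<oplus>\<^bsub>E i\<^esub> snd (p i))
            \<le> (2 + \<epsilon>) * nrm (E i) (y i)" by blast
      define z w where "z = (\<lambda>i\<in>\<Lambda>. fst (p i))" and "w = (\<lambda>i\<in>\<Lambda>. snd (p i))"
      \<comment> \<open>Coordinatewise domination by \<open>y\<close> gives membership in the sum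
        and then norm at most 1.\<close>
      have z: "z \<in> carrier D" and w: "w \<in> carrier D"
        using p by (auto intro!: carrier_D_I[OF _ _ norms_mem[OF yc]] simp: z_def w_def)
      have nz: "nrm D z \<le> 1" and nw: "nrm D w \<le> 1"
        using nrm_D_le[OF _ norms_mem[OF yc], of z] nrm_D_le[OF _ norms_mem[OF yc], of w] p y1
        by (auto simp: z_def w_def nrm_D)
      have Fz: "1 - \<epsilon> \<le> F z" and Fw: "1 - \<epsilon> \<le> F w"
        using p by (auto intro!: F_ge[OF _ yc y1] z w simp: z_def[symmetric] w_def[symmetric])
          (auto simp: z_def w_def)
      note sums = nrm_summable[OF minus_in_D[OF yc z]] nrm_summable[OF add_in_D[OF yc w]]
      have "nrm D (y \<ominus>\<^bsub>D\<^esub> z) + nrm D (y \<oplus>\<^bsub>D\<^esub> w)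
          = (\<Sum>\<^sub>\<infinity>i\<in>\<Lambda>. nrm (E i) ((y \<ominus>\<^bsub>D\<^esub> z) i) + nrm (E i) ((y \<oplus>\<^bsub>D\<^esub> w) i))"
        by (simp add: nrm_sum minus_in_D add_in_D yc z w infsum_add[OF sums])
      also have "\<dots> \<le> (\<Sum>\<^sub>\<infinity>i\<in>\<Lambda>. (2 + \<epsilon>) * nrm (E i) (y i))"
      proof (rule infsum_mono[OF summable_on_add[OF sums] summable_on_cmult_right[OF nrm_summable[OF yc]]])
        fix i assume i: "i \<in> \<Lambda>"
        show "nrm (E i) ((y \<ominus>\<^bsub>D\<^esub> z) i) + nrm (E i) ((y \<oplus>\<^bsub>D\<^esub> w) i) \<le> (2 + \<epsilon>) * nrm (E i) (y i)"
          using p[OF i] i by (simp add: minus_D[OF yc z i] add_D) (simp add: z_def w_def)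
      qed
      also have "\<dots> = 2 + \<epsilon>" using nrm_sum[OF yc] y1 by (simp add: infsum_cmult_right')
      finally show ?thesis
        unfolding near_slices_def using nz nw Fz Fw by (intro bexI[OF _ z] bexI[OF _ w]) auto
    qed
    ultimately show "\<exists>f. contractive D f \<and> 1 - \<epsilon> \<le> f x \<and> (\<forall>y \<in> unit_sphere D. near_slices D f \<epsilon> 1 y)"
      using F_ge[OF xc xc x1 fx] by blast
  qed
qed

theorem theorem2p11:
  fixes \<Lambda> :: "'i set" and E :: "'i \<Rightarrow> 'a normed_space"
  assumes "\<And>i. i \<in> \<Lambda> \<Longrightarrow> banach_space (E i)"
  shows "(GL_space (c0_sum \<Lambda> E) \<longleftrightarrow> (\<forall>i\<in>\<Lambda>. GL_space (E i))) \<and>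
         (GL_space (l1_sum \<Lambda> E) \<longleftrightarrow> (\<forall>i\<in>\<Lambda>. GL_space (E i)))"
proof -
  have c0: "c0_sum \<Lambda> E = direct_sum \<Lambda> E (c0_families \<Lambda>) (c0_norm \<Lambda>)"
    by (simp add: c0_sum_def c0_norm_def[abs_def])
  have l1: "l1_sum \<Lambda> E = direct_sum \<Lambda> E (l1_families \<Lambda>) (l1_norm \<Lambda>)"
    by (simp add: l1_sum_def l1_norm_def[abs_def])
  interpret c0: banach_sum \<Lambda> "c0_families \<Lambda>" "c0_norm \<Lambda>" E
    using sum_norm_c0 assms by (simp add: banach_sum_def banach_sum_axioms_def)
  interpret l1: banach_sum \<Lambda> "l1_families \<Lambda>" "l1_norm \<Lambda>" E
    using sum_norm_l1 assms by (simp add: banach_sum_def banach_sum_axioms_def)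
  show ?thesis
    unfolding c0 l1
    using GL_space_c0_sum[of \<Lambda> E] GL_space_l1_sum[of \<Lambda> E] assms
      c0.GL_space_component l1.GL_space_component by blast
qed

end
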